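(* Over $\mathsf{RCA}_0$ the following are equivalent: (1) $\mathrm{WQP}(\dot\cup^\omega)$: $\forall n\,\forall Q\,[Q\text{ wqo}\to(n\times Q,\le_{\dot\cup})\text{ wqo}]$; (2) $\mathrm{WQP}(\le_\times^\omega)$: $\forall n\,\forall Q\,[Q\text{ wqo}\to(n\times Q,\le_\times)\text{ wqo}]$; (3) $\mathrm{RT}^1_{<\infty}$: for all $n$ and all $f:\mathbb N\to\{0,\dots,n-1\}$ there are an infinite $A\subseteq\mathbb N$ and $i<n$ with $f(j)=i$ for all $j\in A$; (4) $\mathrm{B}\Sigma^0_2$: $\forall x\le a\,\exists y\,\varphi(x,y)\to\exists z\,\forall x\le a\,\exists y\le z\,\varphi(x,y)$ for all $\Sigma^0_2$ formulas $\varphi$.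
   Context: $\mathsf{RCA}_0$ is the base system of second-order arithmetic. A quasi-order $(Q,\le_Q)$ is a wqo if every infinite sequence $(q_k)$ in $Q$ has $i<j$ with $q_i\le_Q q_j$. For $n\in\mathbb N$ (identified with $\{0,\dots,n-1\}$), on $n\times Q$ define $(m_1,q_1)\le_\times(m_2,q_2)$ iff $m_1\le m_2$ and $q_1\le_Q q_2$, and $(m_1,q_1)\le_{\dot\cup}(m_2,q_2)$ iff $m_1=m_2$ and $q_1\le_Q q_2$. *)

theory Defs
  imports Main
begin

section \<open>The two-sorted language of second-order arithmetic\<close>

text \<open>Variables are named by strings; number and set variables have separate name spaces, so the
  number variable \<open>''X''\<close> and the set variable \<open>''X''\<close> are unrelated. There are no set terms other
  than set variables, and equality is primitive for numbers only.\<close>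

datatype tm =
    Var string
  | Zero
  | One
  | Plus tm tm   (infixl "\<^bold>+" 75)
  | Times tm tm  (infixl "\<^bold>*" 80)

datatype fm =
    Eq tm tm          (infix "\<^bold>=" 70)
  | Less tm tm        (infix "\<^bold><" 70)
  | Mem tm string     (infix "\<^bold>\<in>" 70)
  | Neg fm            ("\<^bold>\<not> _" [65] 65)
  | Conj fm fm        (infixr "\<^bold>\<and>" 60)
  | Disj fm fm        (infixr "\<^bold>\<or>" 58)
  | Imp fm fm         (infixr "\<^bold>\<longrightarrow>" 55)
  | Iff fm fm         (infixr "\<^bold>\<longleftrightarrow>" 54)
  | Forall string fm  ("(\<^bold>\<forall>_./ _)" [0, 50] 50)
  | Exists string fm  ("(\<^bold>\<exists>_./ _)" [0, 50] 50)
  | ForallS string fm ("(\<^bold>\<forall>\<^sub>2_./ _)" [0, 50] 50)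
  | ExistsS string fm ("(\<^bold>\<exists>\<^sub>2_./ _)" [0, 50] 50)

definition Le :: "tm \<Rightarrow> tm \<Rightarrow> fm" (infix "\<^bold>\<le>" 70) where
  "s \<^bold>\<le> t = (s \<^bold>< t \<^bold>\<or> s \<^bold>= t)"

primrec vars_tm :: "tm \<Rightarrow> string set" where
  "vars_tm (Var x) = {x}"
| "vars_tm Zero = {}"
| "vars_tm One = {}"
| "vars_tm (s \<^bold>+ t) = vars_tm s \<union> vars_tm t"
| "vars_tm (s \<^bold>* t) = vars_tm s \<union> vars_tm t"

primrec fv :: "fm \<Rightarrow> string set" where
  "fv (s \<^bold>= t) = vars_tm s \<union> vars_tm t"
| "fv (s \<^bold>< t) = vars_tm s \<union> vars_tm t"
| "fv (t \<^bold>\<in> X) = vars_tm t"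
| "fv (\<^bold>\<not> \<phi>) = fv \<phi>"
| "fv (\<phi> \<^bold>\<and> \<psi>) = fv \<phi> \<union> fv \<psi>"
| "fv (\<phi> \<^bold>\<or> \<psi>) = fv \<phi> \<union> fv \<psi>"
| "fv (\<phi> \<^bold>\<longrightarrow> \<psi>) = fv \<phi> \<union> fv \<psi>"
| "fv (\<phi> \<^bold>\<longleftrightarrow> \<psi>) = fv \<phi> \<union> fv \<psi>"
| "fv (\<^bold>\<forall>x. \<phi>) = fv \<phi> - {x}"
| "fv (\<^bold>\<exists>x. \<phi>) = fv \<phi> - {x}"
| "fv (\<^bold>\<forall>\<^sub>2X. \<phi>) = fv \<phi>"
| "fv (\<^bold>\<exists>\<^sub>2X. \<phi>) = fv \<phi>"

primrec fv_set :: "fm \<Rightarrow> string set" where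
  "fv_set (s \<^bold>= t) = {}"
| "fv_set (s \<^bold>< t) = {}"
| "fv_set (t \<^bold>\<in> X) = {X}"
| "fv_set (\<^bold>\<not> \<phi>) = fv_set \<phi>"
| "fv_set (\<phi> \<^bold>\<and> \<psi>) = fv_set \<phi> \<union> fv_set \<psi>"
| "fv_set (\<phi> \<^bold>\<or> \<psi>) = fv_set \<phi> \<union> fv_set \<psi>"
| "fv_set (\<phi> \<^bold>\<longrightarrow> \<psi>) = fv_set \<phi> \<union> fv_set \<psi>"
| "fv_set (\<phi> \<^bold>\<longleftrightarrow> \<psi>) = fv_set \<phi> \<union> fv_set \<psi>"
| "fv_set (\<^bold>\<forall>x. \<phi>) = fv_set \<phi>"
| "fv_set (\<^bold>\<exists>x. \<phi>) = fv_set \<phi>"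
| "fv_set (\<^bold>\<forall>\<^sub>2X. \<phi>) = fv_set \<phi> - {X}"
| "fv_set (\<^bold>\<exists>\<^sub>2X. \<phi>) = fv_set \<phi> - {X}"


section \<open>Structures and satisfaction\<close>

text \<open>The first-order part of a structure is the whole type \<open>'a\<close>; set variables range over the
  family \<open>sets\<close> of subsets of \<open>'a\<close>, which need not be the full power set.\<close>

record 'a structure2 =
  zero :: 'a
  one :: 'a
  plus :: "'a \<Rightarrow> 'a \<Rightarrow> 'a"
  times :: "'a \<Rightarrow> 'a \<Rightarrow> 'a"
  less :: "'a \<Rightarrow> 'a \<Rightarrow> bool"
  sets :: "'a set set"

primrec eval :: "'a structure2 \<Rightarrow> (string \<Rightarrow> 'a) \<Rightarrow> tm \<Rightarrow> 'a" where
  "eval M e (Var x) = e x"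
| "eval M e Zero = zero M"
| "eval M e One = one M"
| "eval M e (s \<^bold>+ t) = plus M (eval M e s) (eval M e t)"
| "eval M e (s \<^bold>* t) = times M (eval M e s) (eval M e t)"

primrec sat :: "'a structure2 \<Rightarrow> (string \<Rightarrow> 'a) \<Rightarrow> (string \<Rightarrow> 'a set) \<Rightarrow> fm \<Rightarrow> bool" where
  "sat M e E (s \<^bold>= t) \<longleftrightarrow> eval M e s = eval M e t"
| "sat M e E (s \<^bold>< t) \<longleftrightarrow> less M (eval M e s) (eval M e t)"
| "sat M e E (t \<^bold>\<in> X) \<longleftrightarrow> eval M e t \<in> E X"
| "sat M e E (\<^bold>\<not> \<phi>) \<longleftrightarrow> \<not> sat M e E \<phi>"
| "sat M e E (\<phi> \<^bold>\<and> \<psi>) \<longleftrightarrow> sat M e E \<phi> \<and> sat M e E \<psi>"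
| "sat M e E (\<phi> \<^bold>\<or> \<psi>) \<longleftrightarrow> sat M e E \<phi> \<or> sat M e E \<psi>"
| "sat M e E (\<phi> \<^bold>\<longrightarrow> \<psi>) \<longleftrightarrow> (sat M e E \<phi> \<longrightarrow> sat M e E \<psi>)"
| "sat M e E (\<phi> \<^bold>\<longleftrightarrow> \<psi>) \<longleftrightarrow> (sat M e E \<phi> \<longleftrightarrow> sat M e E \<psi>)"
| "sat M e E (\<^bold>\<forall>x. \<phi>) \<longleftrightarrow> (\<forall>a. sat M (e(x := a)) E \<phi>)"
| "sat M e E (\<^bold>\<exists>x. \<phi>) \<longleftrightarrow> (\<exists>a. sat M (e(x := a)) E \<phi>)"
| "sat M e E (\<^bold>\<forall>\<^sub>2X. \<phi>) \<longleftrightarrow> (\<forall>A\<in>sets M. sat M e (E(X := A)) \<phi>)"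
| "sat M e E (\<^bold>\<exists>\<^sub>2X. \<phi>) \<longleftrightarrow> (\<exists>A\<in>sets M. sat M e (E(X := A)) \<phi>)"

text \<open>Both domains of a model are nonempty, and formulas with free variables are read as their
  universal closures.\<close>

definition models :: "'a structure2 \<Rightarrow> fm set \<Rightarrow> bool" (infix "\<^bold>\<Turnstile>" 50) where
  "M \<^bold>\<Turnstile> T \<longleftrightarrow> sets M \<noteq> {} \<and>
     (\<forall>\<phi>\<in>T. \<forall>e E. (\<forall>X. E X \<in> sets M) \<longrightarrow> sat M e E \<phi>)"


section \<open>Arithmetical hierarchy\<close>

inductive bounded_fm :: "fm \<Rightarrow> bool" where
  "bounded_fm (s \<^bold>= t)"
| "bounded_fm (s \<^bold>< t)"
| "bounded_fm (t \<^bold>\<in> X)"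
| "bounded_fm \<phi> \<Longrightarrow> bounded_fm (\<^bold>\<not> \<phi>)"
| "bounded_fm \<phi> \<Longrightarrow> bounded_fm \<psi> \<Longrightarrow> bounded_fm (\<phi> \<^bold>\<and> \<psi>)"
| "bounded_fm \<phi> \<Longrightarrow> bounded_fm \<psi> \<Longrightarrow> bounded_fm (\<phi> \<^bold>\<or> \<psi>)"
| "bounded_fm \<phi> \<Longrightarrow> bounded_fm \<psi> \<Longrightarrow> bounded_fm (\<phi> \<^bold>\<longrightarrow> \<psi>)"
| "bounded_fm \<phi> \<Longrightarrow> bounded_fm \<psi> \<Longrightarrow> bounded_fm (\<phi> \<^bold>\<longleftrightarrow> \<psi>)"
| "bounded_fm \<phi> \<Longrightarrow> x \<notin> vars_tm t \<Longrightarrow> bounded_fm (\<^bold>\<forall>x. Var x \<^bold>< t \<^bold>\<longrightarrow> \<phi>)"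
| "bounded_fm \<phi> \<Longrightarrow> x \<notin> vars_tm t \<Longrightarrow> bounded_fm (\<^bold>\<forall>x. Var x \<^bold>\<le> t \<^bold>\<longrightarrow> \<phi>)"
| "bounded_fm \<phi> \<Longrightarrow> x \<notin> vars_tm t \<Longrightarrow> bounded_fm (\<^bold>\<exists>x. Var x \<^bold>< t \<^bold>\<and> \<phi>)"
| "bounded_fm \<phi> \<Longrightarrow> x \<notin> vars_tm t \<Longrightarrow> bounded_fm (\<^bold>\<exists>x. Var x \<^bold>\<le> t \<^bold>\<and> \<phi>)"

definition Sigma01 :: "fm set" where
  "Sigma01 = {\<^bold>\<exists>x. \<theta> | x \<theta>. bounded_fm \<theta>}"

definition Pi01 :: "fm set" where
  "Pi01 = {\<^bold>\<forall>x. \<theta> | x \<theta>. bounded_fm \<theta>}"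

definition Sigma02 :: "fm set" where
  "Sigma02 = {\<^bold>\<exists>x. \<phi> | x \<phi>. \<phi> \<in> Pi01}"


section \<open>The system RCA0 and the bounding scheme\<close>

definition basic_axioms :: "fm set" where
  "basic_axioms =
    (let m = Var ''m''; n = Var ''n'' in
     { \<^bold>\<not> (n \<^bold>+ One \<^bold>= Zero),
       m \<^bold>+ One \<^bold>= n \<^bold>+ One \<^bold>\<longrightarrow> m \<^bold>= n,
       m \<^bold>+ Zero \<^bold>= m,
       m \<^bold>+ (n \<^bold>+ One) \<^bold>= (m \<^bold>+ n) \<^bold>+ One,
       m \<^bold>* Zero \<^bold>= Zero,
       m \<^bold>* (n \<^bold>+ One) \<^bold>= (m \<^bold>* n) \<^bold>+ m,
       \<^bold>\<not> (m \<^bold>< Zero),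
       m \<^bold>< n \<^bold>+ One \<^bold>\<longleftrightarrow> (m \<^bold>< n \<^bold>\<or> m \<^bold>= n) })"

text \<open>\<open>inst \<phi> x t\<close> expresses \<open>\<phi>(t)\<close>, where \<open>x\<close> is the displayed variable of \<open>\<phi>\<close>, without
  capture-avoiding substitution. It is used only if \<open>x\<close> does not occur in \<open>t\<close>.\<close>

definition inst :: "fm \<Rightarrow> string \<Rightarrow> tm \<Rightarrow> fm" where
  "inst \<phi> x t = (\<^bold>\<forall>x. Var x \<^bold>= t \<^bold>\<longrightarrow> \<phi>)"

definition Sigma01_induction :: "fm set" where
  "Sigma01_induction =
    { inst \<phi> x Zero \<^bold>\<and> (\<^bold>\<forall>n. inst \<phi> x (Var n) \<^bold>\<longrightarrow> inst \<phi> x (Var n \<^bold>+ One)) \<^bold>\<longrightarrow> (\<^bold>\<forall>x. \<phi>)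
      | \<phi> x n. \<phi> \<in> Sigma01 \<and> n \<noteq> x \<and> n \<notin> fv \<phi> }"

definition Delta01_comprehension :: "fm set" where
  "Delta01_comprehension =
    { (\<^bold>\<forall>n. \<phi> \<^bold>\<longleftrightarrow> \<psi>) \<^bold>\<longrightarrow> (\<^bold>\<exists>\<^sub>2X. \<^bold>\<forall>n. Var n \<^bold>\<in> X \<^bold>\<longleftrightarrow> \<phi>)
      | \<phi> \<psi> n X. \<phi> \<in> Sigma01 \<and> \<psi> \<in> Pi01 \<and> X \<notin> fv_set \<phi> }"

definition RCA0 :: "fm set" where
  "RCA0 = basic_axioms \<union> Sigma01_induction \<union> Delta01_comprehension"

definition BSigma02 :: "fm set" where
  "BSigma02 =
    { (\<^bold>\<forall>x. Var x \<^bold>\<le> Var a \<^bold>\<longrightarrow> (\<^bold>\<exists>y. \<phi>)) \<^bold>\<longrightarrow>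
      (\<^bold>\<exists>z. \<^bold>\<forall>x. Var x \<^bold>\<le> Var a \<^bold>\<longrightarrow> (\<^bold>\<exists>y. Var y \<^bold>\<le> Var z \<^bold>\<and> \<phi>))
      | \<phi> x y z a. \<phi> \<in> Sigma02 \<and> distinct [x, y, z, a] \<and> z \<notin> fv \<phi> }"


section \<open>Well-quasi-orders and the pigeonhole principle in the formal language\<close>

text \<open>The usual coding \<open>(s + t)\<^sup>2 + s\<close> of the ordered pair \<open>(s, t)\<close> by a number; it is
  injective provably in RCA0.\<close>

definition pr :: "tm \<Rightarrow> tm \<Rightarrow> tm" where
  "pr s t = (s \<^bold>+ t) \<^bold>* (s \<^bold>+ t) \<^bold>+ s"

text \<open>Below, \<open>F\<close>, \<open>P\<close>, \<open>Q\<close>, \<open>R\<close>, \<open>S\<close> are names of set variables. To avoid capture, the arguments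
  of \<open>is_wqo\<close> must differ from its bound set variable \<open>''F''\<close>. Functions are total functions on the
  numbers, given as sets of codes of pairs.\<close>

definition is_function :: "string \<Rightarrow> fm" where
  "is_function F =
    (let i = Var ''i''; j = Var ''j''; k = Var ''k''; p = Var ''p'' in
     (\<^bold>\<forall>''p''. p \<^bold>\<in> F \<^bold>\<longrightarrow> (\<^bold>\<exists>''i''. \<^bold>\<exists>''j''. p \<^bold>= pr i j)) \<^bold>\<and>
     (\<^bold>\<forall>''i''. \<^bold>\<exists>''j''. pr i j \<^bold>\<in> F) \<^bold>\<and>
     (\<^bold>\<forall>''i''. \<^bold>\<forall>''j''. \<^bold>\<forall>''k''. pr i j \<^bold>\<in> F \<^bold>\<and> pr i k \<^bold>\<in> F \<^bold>\<longrightarrow> j \<^bold>= k))"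

definition is_quasi_order :: "string \<Rightarrow> string \<Rightarrow> fm" where
  "is_quasi_order Q R =
    (let a = Var ''a''; b = Var ''b''; c = Var ''c''; p = Var ''p'' in
     (\<^bold>\<forall>''p''. p \<^bold>\<in> R \<^bold>\<longrightarrow> (\<^bold>\<exists>''a''. \<^bold>\<exists>''b''. a \<^bold>\<in> Q \<^bold>\<and> b \<^bold>\<in> Q \<^bold>\<and> p \<^bold>= pr a b)) \<^bold>\<and>
     (\<^bold>\<forall>''a''. a \<^bold>\<in> Q \<^bold>\<longrightarrow> pr a a \<^bold>\<in> R) \<^bold>\<and>
     (\<^bold>\<forall>''a''. \<^bold>\<forall>''b''. \<^bold>\<forall>''c''. pr a b \<^bold>\<in> R \<^bold>\<and> pr b c \<^bold>\<in> R \<^bold>\<longrightarrow> pr a c \<^bold>\<in> R))"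

definition is_wqo :: "string \<Rightarrow> string \<Rightarrow> fm" where
  "is_wqo Q R =
    (let i = Var ''i''; j = Var ''j''; a = Var ''a''; b = Var ''b'' in
     is_quasi_order Q R \<^bold>\<and>
     (\<^bold>\<forall>\<^sub>2''F''. is_function ''F'' \<^bold>\<and> (\<^bold>\<forall>''i''. \<^bold>\<forall>''a''. pr i a \<^bold>\<in> ''F'' \<^bold>\<longrightarrow> a \<^bold>\<in> Q) \<^bold>\<longrightarrow>
       (\<^bold>\<exists>''i''. \<^bold>\<exists>''j''. \<^bold>\<exists>''a''. \<^bold>\<exists>''b''.
          i \<^bold>< j \<^bold>\<and> pr i a \<^bold>\<in> ''F'' \<^bold>\<and> pr j b \<^bold>\<in> ''F'' \<^bold>\<and> pr a b \<^bold>\<in> R)))"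

text \<open>\<open>P = n \<times> Q\<close>, for the number variable \<open>''n''\<close>.\<close>

definition is_times :: "string \<Rightarrow> string \<Rightarrow> fm" where
  "is_times P Q =
    (let p = Var ''p''; n = Var ''n''; m = Var ''m''; q = Var ''q'' in
     \<^bold>\<forall>''p''. p \<^bold>\<in> P \<^bold>\<longleftrightarrow>
       (\<^bold>\<exists>''m''. \<^bold>\<exists>''q''. m \<^bold>< n \<^bold>\<and> q \<^bold>\<in> Q \<^bold>\<and> p \<^bold>= pr m q))"

text \<open>\<open>S\<close> is the relation on \<open>n \<times> Q\<close> that compares first components by \<open>cmp\<close> and second components
  by \<open>R\<close>.\<close>

definition is_times_order :: "(tm \<Rightarrow> tm \<Rightarrow> fm) \<Rightarrow> string \<Rightarrow> string \<Rightarrow> string \<Rightarrow> fm" where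
  "is_times_order cmp S Q R =
    (let p = Var ''p''; n = Var ''n'';
         m1 = Var ''m1''; q1 = Var ''q1''; m2 = Var ''m2''; q2 = Var ''q2'' in
     \<^bold>\<forall>''p''. p \<^bold>\<in> S \<^bold>\<longleftrightarrow>
       (\<^bold>\<exists>''m1''. \<^bold>\<exists>''q1''. \<^bold>\<exists>''m2''. \<^bold>\<exists>''q2''.
          m1 \<^bold>< n \<^bold>\<and> q1 \<^bold>\<in> Q \<^bold>\<and> m2 \<^bold>< n \<^bold>\<and> q2 \<^bold>\<in> Q \<^bold>\<and>
          cmp m1 m2 \<^bold>\<and> pr q1 q2 \<^bold>\<in> R \<^bold>\<and> p \<^bold>= pr (pr m1 q1) (pr m2 q2)))"

definition WQP :: "(tm \<Rightarrow> tm \<Rightarrow> fm) \<Rightarrow> fm" where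
  "WQP cmp =
    (\<^bold>\<forall>''n''. \<^bold>\<forall>\<^sub>2''Q''. \<^bold>\<forall>\<^sub>2''R''. is_wqo ''Q'' ''R'' \<^bold>\<longrightarrow>
       (\<^bold>\<exists>\<^sub>2''P''. \<^bold>\<exists>\<^sub>2''S''. is_times ''P'' ''Q'' \<^bold>\<and> is_times_order cmp ''S'' ''Q'' ''R'' \<^bold>\<and>
          is_wqo ''P'' ''S''))"

definition WQP_disjoint_union :: fm where
  "WQP_disjoint_union = WQP Eq"

definition WQP_product :: fm where
  "WQP_product = WQP Le"

definition RT1 :: fm where
  "RT1 =
    (let n = Var ''n''; i = Var ''i''; j = Var ''j''; k = Var ''k'' in
     \<^bold>\<forall>''n''. \<^bold>\<forall>\<^sub>2''F''. is_function ''F'' \<^bold>\<and> (\<^bold>\<forall>''j''. \<^bold>\<forall>''i''. pr j i \<^bold>\<in> ''F'' \<^bold>\<longrightarrow> i \<^bold>< n) \<^bold>\<longrightarrow>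
       (\<^bold>\<exists>\<^sub>2''A''. \<^bold>\<exists>''i''.
          (\<^bold>\<forall>''k''. \<^bold>\<exists>''j''. k \<^bold>< j \<^bold>\<and> j \<^bold>\<in> ''A'') \<^bold>\<and> i \<^bold>< n \<^bold>\<and>
          (\<^bold>\<forall>''j''. j \<^bold>\<in> ''A'' \<^bold>\<longrightarrow> pr j i \<^bold>\<in> ''F'')))"

end

theory Submission
  imports Defs
begin

text \<open>Work inside a fixed model, with classes of predicates closed under the logical operations (bounded for
  \<open>delta0\<close>) in place of formulas; they are definable by formulas with parameters, so the model satisfies
  induction and comprehension for them.

  From the pigeonhole principle to bounding: if there is no bound, then for each \<open>w\<close> search for a pair
  \<open>(s, x)\<close> such that \<open>s\<close> refutes all witnesses below \<open>w\<close> for \<open>x \<le> a\<close>, and colour \<open>w\<close> by this \<open>x\<close>. A colour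
  that occurs infinitely often has no witness at all. Conversely, bounding applied to "colour \<open>x\<close> does not
  occur beyond \<open>y\<close>" gives a number that has no colour.

  From the pigeonhole principle to products: restrict a sequence in \<open>n \<times> Q\<close> to an infinite set on which the
  first component is constant. This set must be enumerated increasingly, hence by recursion, for which
  finite sets are coded by divisibility. From products to the pigeonhole principle: a colouring without
  infinite homogeneous set gives a wqo on the numbers whose product with \<open>n\<close> has a bad sequence.\<close>

text \<open>Only Sigma_1 induction is at hand, and this decides the form of most arguments. If
  bounding fails, then for each w some x <= a has a refuting v for every y, u <= w;
  \<open>collection\<close> bounds all these v by one number s, so the failure becomes a bounded
  property of s and the colour of w is found by a search. In the passage from products to the
  pigeonhole principle the homogeneous colour is the maximum of a bounded Sigma_1 class, which
  Sigma_1 induction provides. For recursion, exponentiation is not a symbol of the language, so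
  codes of finite sets must work with sums and products alone: Goedel's coprime moduli m (i + 1) + 1
  do this. Elements and sets of the model have no names; a predicate becomes a formula by turning
  its finitely many parameters into free variables with fresh names, and the axioms apply because
  they are read as universal closures. The product order extends that of the disjoint union, which
  closes the cycle between the two preservation statements and the pigeonhole principle.\<close>

text \<open>Environments \<open>e\<close> use de Bruijn indices: in the body of a quantifier, \<open>e 0\<close> is the bound variable
  and \<open>e (Suc i)\<close> is variable \<open>i\<close> outside. Elements and sets of the model occur directly, as parameters.\<close>

inductive term_fun :: "'a structure2 \<Rightarrow> ((nat \<Rightarrow> 'a) \<Rightarrow> 'a) \<Rightarrow> bool" for M where
  var: "term_fun M (\<lambda>e. e i)"
| const: "term_fun M (\<lambda>e. c)"
| plus: "term_fun M s \<Longrightarrow> term_fun M t \<Longrightarrow> term_fun M (\<lambda>e. plus M (s e) (t e))"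
| times: "term_fun M s \<Longrightarrow> term_fun M t \<Longrightarrow> term_fun M (\<lambda>e. times M (s e) (t e))"

text \<open>In \<open>bex\<close> the body \<open>Q\<close> takes the outer environment and the
  bound element separately, so that the rules unify with ordinary quantifiers and definability goals
  are solved by \<open>intro\<close>.\<close>

inductive delta0 :: "'a structure2 \<Rightarrow> ((nat \<Rightarrow> 'a) \<Rightarrow> bool) \<Rightarrow> bool" for M where
  eq: "term_fun M s \<Longrightarrow> term_fun M t \<Longrightarrow> delta0 M (\<lambda>e. s e = t e)"
| less: "term_fun M s \<Longrightarrow> term_fun M t \<Longrightarrow> delta0 M (\<lambda>e. less M (s e) (t e))"
| mem: "A \<in> sets M \<Longrightarrow> term_fun M t \<Longrightarrow> delta0 M (\<lambda>e. t e \<in> A)"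
| neg: "delta0 M P \<Longrightarrow> delta0 M (\<lambda>e. \<not> P e)"
| conj: "delta0 M P \<Longrightarrow> delta0 M Q \<Longrightarrow> delta0 M (\<lambda>e. P e \<and> Q e)"
| bex: "term_fun M t \<Longrightarrow> delta0 M (\<lambda>e. Q (\<lambda>i. e (Suc i)) (e 0)) \<Longrightarrow>
    delta0 M (\<lambda>e. \<exists>x. less M x (t e) \<and> Q e x)"

lemma delta0_disj: "delta0 M P \<Longrightarrow> delta0 M Q \<Longrightarrow> delta0 M (\<lambda>e. P e \<or> Q e)"
  using delta0.neg[OF delta0.conj[OF delta0.neg[of M P] delta0.neg[of M Q]]] by simp

lemma delta0_imp: "delta0 M P \<Longrightarrow> delta0 M Q \<Longrightarrow> delta0 M (\<lambda>e. P e \<longrightarrow> Q e)"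
  using delta0.neg[OF delta0.conj[OF _ delta0.neg[of M Q], of P]] by simp

lemma delta0_iff: "delta0 M P \<Longrightarrow> delta0 M Q \<Longrightarrow> delta0 M (\<lambda>e. P e \<longleftrightarrow> Q e)"
  using delta0.conj[OF delta0_imp[of M P Q] delta0_imp[of M Q P]]
  by (simp add: iff_conv_conj_imp)

lemma delta0_ball: "term_fun M t \<Longrightarrow> delta0 M (\<lambda>e. Q (\<lambda>i. e (Suc i)) (e 0)) \<Longrightarrow>
    delta0 M (\<lambda>e. \<forall>x. less M x (t e) \<longrightarrow> Q e x)"
  using delta0.neg[OF delta0.bex[of M t "\<lambda>e x. \<not> Q e x", OF _ delta0.neg]] by simp

lemma delta0_bool: "delta0 M (\<lambda>e. b)"
proof -
  have "delta0 M (\<lambda>e. zero M = zero M)" "delta0 M (\<lambda>e. \<not> zero M = zero M)"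
    by (intro delta0.neg delta0.eq term_fun.const)+
  then show ?thesis by (cases b) simp_all
qed

lemma term_fun_subst:
  assumes "term_fun M t" "\<And>i. term_fun M (\<tau> i)"
  shows "term_fun M (\<lambda>e. t (\<lambda>i. \<tau> i e))"
  using assms(1) by induction (auto intro: assms(2) term_fun.intros)

lemma term_fun_shift: "term_fun M t \<Longrightarrow> term_fun M (\<lambda>e. t (\<lambda>i. e (Suc i)))"
  by (rule term_fun_subst[of M t "\<lambda>i e. e (Suc i)"]) (auto intro: term_fun.var)

lemma delta0_subst:
  assumes "delta0 M P" "\<And>i. term_fun M (\<tau> i)"
  shows "delta0 M (\<lambda>e. P (\<lambda>i. \<tau> i e))"
  using assms
proof (induction arbitrary: \<tau>)
  case (bex t Q)
  \<comment> \<open>The substitution lifted under a binder: index 0 stays, all other terms are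
    shifted.\<close>
  define \<tau>' where "\<tau>' i = (case i of 0 \<Rightarrow> (\<lambda>e. e 0) | Suc j \<Rightarrow> (\<lambda>e. \<tau> j (\<lambda>i. e (Suc i))))" for i
  have "term_fun M (\<tau>' i)" for i
    by (cases i) (auto simp: \<tau>'_def intro: term_fun.var term_fun_shift bex.prems)
  from bex.IH[of \<tau>', OF this]
  have "delta0 M (\<lambda>e. Q (\<lambda>i. \<tau> i (\<lambda>i. e (Suc i))) (e 0))" by (simp add: \<tau>'_def)
  from delta0.bex[OF term_fun_subst[OF bex.hyps(1) bex.prems], of "\<lambda>e. Q (\<lambda>i. \<tau> i e)", OF this]
  show ?case .
qed (auto intro!: delta0.intros intro: term_fun_subst)

text \<open>A HOL predicate \<open>P\<close> on elements counts as bounded if \<open>P (e 0)\<close>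
  is; this rule and its variants below then allow arbitrary terms as arguments.\<close>

lemma delta0_subst1:
  assumes "delta0 M (\<lambda>e. P (e 0))" "term_fun M s"
  shows "delta0 M (\<lambda>e. P (s e))"
  using delta0_subst[OF assms(1), of "\<lambda>_. s"] assms(2) by simp

lemma delta0_subst2:
  assumes "delta0 M (\<lambda>e. P (e 0) (e 1))" "term_fun M s" "term_fun M t"
  shows "delta0 M (\<lambda>e. P (s e) (t e))"
  using delta0_subst[OF assms(1), of "\<lambda>i. if i = 0 then s else t"] assms(2,3) by simp

lemma delta0_subst4:
  assumes "delta0 M (\<lambda>e. P (e 0) (e 1) (e 2) (e 3))"
    "term_fun M s" "term_fun M t" "term_fun M u" "term_fun M v"
  shows "delta0 M (\<lambda>e. P (s e) (t e) (u e) (v e))"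
  using delta0_subst[OF assms(1), of "\<lambda>i. if i = 0 then s else if i = 1 then t else if i = 2 then u else v"]
    assms(2-)
  by simp

section \<open>Representability by bounded formulas\<close>

lemma eval_term_fun:
  "(\<And>x. x \<in> vars_tm t \<Longrightarrow> term_fun M (\<tau> x)) \<Longrightarrow> term_fun M (\<lambda>e. eval M (\<lambda>x. \<tau> x e) t)"
  by (induction t) (auto intro: term_fun.intros)

lemma eval_cong: "(\<And>x. x \<in> vars_tm t \<Longrightarrow> e x = e' x) \<Longrightarrow> eval M e t = eval M e' t"
  by (induction t) auto

text \<open>Brings the matrix of an arbitrary instance of the bounding scheme into the semantic
  class. The map \<open>\<tau>\<close> sends names to terms over de Bruijn environments; letting it
  vary carries the induction through binders.\<close>

lemma sat_bounded_delta0: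
  assumes "bounded_fm \<phi>" "\<And>X. E X \<in> sets M" "\<And>x. term_fun M (\<tau> x)"
  shows "delta0 M (\<lambda>e. sat M (\<lambda>x. \<tau> x e) E \<phi>)"
proof -
  \<comment> \<open>The bound name \<open>y\<close> becomes index 0, also when it shadows an outer
    use of the same name.\<close>
  define \<tau>' where "\<tau>' \<tau> y x = (if x = y then (\<lambda>e. e 0) else (\<lambda>e. \<tau> x (\<lambda>i. e (Suc i))))"
    for \<tau> :: "string \<Rightarrow> (nat \<Rightarrow> 'a) \<Rightarrow> 'a" and y x
  have \<tau>': "(\<And>x. term_fun M (\<tau> x)) \<Longrightarrow> term_fun M (\<tau>' \<tau> y x)" for \<tau> y x
    by (auto simp: \<tau>'_def intro: term_fun.var term_fun_shift)
  have upd: "(\<lambda>x. \<tau>' \<tau> y x e) = (\<lambda>x. \<tau> x (\<lambda>i. e (Suc i)))(y := e 0)" for \<tau> y e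
    by (auto simp: \<tau>'_def)
  note tm = eval_term_fun[of _ M]
  have ex: "delta0 M (\<lambda>e. \<exists>a. less M a (eval M ((\<lambda>x. \<tau> x e)(x := a)) t) \<and> Q ((\<lambda>x. \<tau> x e)(x := a)))"
    and all: "delta0 M (\<lambda>e. \<forall>a. less M a (eval M ((\<lambda>x. \<tau> x e)(x := a)) t) \<longrightarrow> Q ((\<lambda>x. \<tau> x e)(x := a)))"
    and eqsub: "delta0 M (\<lambda>e. Q ((\<lambda>x. \<tau> x e)(x := eval M (\<lambda>x. \<tau> x e) t)))"
    if IH: "\<And>\<tau>. (\<And>x. term_fun M (\<tau> x)) \<Longrightarrow> delta0 M (\<lambda>e. Q (\<lambda>x. \<tau> x e))"
      and fresh: "x \<notin> vars_tm t" and T: "\<And>x. term_fun M (\<tau> x)" for Q \<tau> x t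
  proof -
    have ev: "eval M ((\<lambda>x. \<tau> x e)(x := a)) t = eval M (\<lambda>x. \<tau> x e) t" for e a
      using fresh by (intro eval_cong) auto
    have d: "delta0 M (\<lambda>e. Q ((\<lambda>x. \<tau> x (\<lambda>i. e (Suc i)))(x := e 0)))"
      using IH[of "\<tau>' \<tau> x", OF \<tau>'[OF T]] by (simp add: upd)
    show "delta0 M (\<lambda>e. \<exists>a. less M a (eval M ((\<lambda>x. \<tau> x e)(x := a)) t) \<and> Q ((\<lambda>x. \<tau> x e)(x := a)))"
      unfolding ev by (intro delta0.bex tm T d)
    show "delta0 M (\<lambda>e. \<forall>a. less M a (eval M ((\<lambda>x. \<tau> x e)(x := a)) t) \<longrightarrow> Q ((\<lambda>x. \<tau> x e)(x := a)))"
      unfolding ev by (intro delta0_ball tm T d)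
    have eq: "(\<lambda>x. \<tau> x e)(x := eval M (\<lambda>x. \<tau> x e) t) =
      (\<lambda>y. (if y = x then (\<lambda>e. eval M (\<lambda>x. \<tau> x e) t) else \<tau> y) e)" for e by auto
    show "delta0 M (\<lambda>e. Q ((\<lambda>x. \<tau> x e)(x := eval M (\<lambda>x. \<tau> x e) t)))"
      unfolding eq by (rule IH) (auto intro: tm T)
  qed
  show ?thesis using assms(1,3)
  proof (induction arbitrary: \<tau>)
    case (9 \<phi> x t)
    from all[where Q="\<lambda>e. sat M e E \<phi>", OF 9(3) 9(2) 9(4)] show ?case by simp
  next
    case (10 \<phi> x t)
    have ev: "eval M ((\<lambda>x. \<tau> x e)(x := a)) t = eval M (\<lambda>x. \<tau> x e) t" for e a
      using 10(2) by (intro eval_cong) auto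
    \<comment> \<open>In an arbitrary structure a bound \<open>\<le> t\<close> cannot be rewritten
      as \<open>< t + 1\<close>; it is split into the strict bound and the instance at
      \<open>t\<close> itself, handled by \<open>eqsub\<close>.\<close>
    have "delta0 M (\<lambda>e. (\<forall>a. less M a (eval M ((\<lambda>x. \<tau> x e)(x := a)) t) \<longrightarrow> sat M ((\<lambda>x. \<tau> x e)(x := a)) E \<phi>)
      \<and> sat M ((\<lambda>x. \<tau> x e)(x := eval M (\<lambda>x. \<tau> x e) t)) E \<phi>)"
      by (intro delta0.conj all eqsub 10)
    then show ?case by (rule back_subst[where P="delta0 M"]) (auto simp: Le_def ev)
  next
    case (11 \<phi> x t)
    from ex[where Q="\<lambda>e. sat M e E \<phi>", OF 11(3) 11(2) 11(4)] show ?case by simp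
  next
    case (12 \<phi> x t)
    have ev: "eval M ((\<lambda>x. \<tau> x e)(x := a)) t = eval M (\<lambda>x. \<tau> x e) t" for e a
      using 12(2) by (intro eval_cong) auto
    have "delta0 M (\<lambda>e. (\<exists>a. less M a (eval M ((\<lambda>x. \<tau> x e)(x := a)) t) \<and> sat M ((\<lambda>x. \<tau> x e)(x := a)) E \<phi>)
      \<or> sat M ((\<lambda>x. \<tau> x e)(x := eval M (\<lambda>x. \<tau> x e) t)) E \<phi>)"
      by (intro delta0_disj ex eqsub 12)
    then show ?case by (rule back_subst[where P="delta0 M"]) (auto simp: Le_def ev)
  qed (simp_all, (intro delta0.intros delta0_disj delta0_imp delta0_iff tm assms(2); blast)+)
qed

text \<open>The parameters \<open>C\<close> are fixed before their names \<open>cn\<close> and the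
  names \<open>\<sigma>\<close> of the indices, so that the names can later be chosen fresh for
  given parameters.\<close>

lemma term_fun_represent:
  assumes "term_fun M t"
  shows "\<exists>C. finite C \<and> (\<forall>cn \<sigma>. \<exists>u. vars_tm u \<subseteq> range \<sigma> \<union> cn ` C \<and>
    (\<forall>e. (\<forall>c\<in>C. e (cn c) = c) \<longrightarrow> eval M e u = t (\<lambda>i. e (\<sigma> i))))"
proof -
  define rep where "rep C t \<longleftrightarrow> finite C \<and> (\<forall>cn (\<sigma> :: nat \<Rightarrow> string). \<exists>u. vars_tm u \<subseteq> range \<sigma> \<union> cn ` C \<and>
    (\<forall>e. (\<forall>c\<in>C. e (cn c) = c) \<longrightarrow> eval M e u = t (\<lambda>i. e (\<sigma> i))))" for C t
  have bin: "rep (C \<union> D) (\<lambda>e. f (s e) (t e))"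
    if "rep C s" "rep D t" and "\<And>u v e. eval M e (F u v) = f (eval M e u) (eval M e v)"
      and "\<And>u v. vars_tm (F u v) = vars_tm u \<union> vars_tm v" for C D s t f F
    unfolding rep_def
  proof (intro conjI allI)
    show "finite (C \<union> D)" using that(1,2) by (simp add: rep_def)
    fix cn and \<sigma> :: "nat \<Rightarrow> string"
    from that(1,2) obtain u v where
      "vars_tm u \<subseteq> range \<sigma> \<union> cn ` C" "\<forall>e. (\<forall>c\<in>C. e (cn c) = c) \<longrightarrow> eval M e u = s (\<lambda>i. e (\<sigma> i))"
      "vars_tm v \<subseteq> range \<sigma> \<union> cn ` D" "\<forall>e. (\<forall>c\<in>D. e (cn c) = c) \<longrightarrow> eval M e v = t (\<lambda>i. e (\<sigma> i))"
      unfolding rep_def by metis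
    then show "\<exists>u. vars_tm u \<subseteq> range \<sigma> \<union> cn ` (C \<union> D) \<and>
      (\<forall>e. (\<forall>c\<in>C \<union> D. e (cn c) = c) \<longrightarrow> eval M e u = f (s (\<lambda>i. e (\<sigma> i))) (t (\<lambda>i. e (\<sigma> i))))"
      by (intro exI[of _ "F u v"]) (auto simp: that(3,4))
  qed
  from assms have "\<exists>C. rep C t"
  proof induction
    case (var i)
    have "rep {} (\<lambda>e. e i)" unfolding rep_def
      by (intro conjI allI, simp, rule_tac x="Var (\<sigma> i)" in exI) auto
    then show ?case by blast
  next
    case (const c)
    have "rep {c} (\<lambda>e. c)" unfolding rep_def
      by (intro conjI allI, simp, rule_tac x="Var (cn c)" in exI) auto
    then show ?case by blast
  next
    case (plus s t)
    then show ?case using bin[where F=Plus and f="plus M"] by fastforce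
  next
    case (times s t)
    then show ?case using bin[where F=Times and f="times M"] by fastforce
  qed
  then show ?thesis unfolding rep_def .
qed

text \<open>Infinitely many names outside the range of \<open>\<sigma>\<close> leave a fresh one for
  every bounded quantifier.\<close>

lemma delta0_represent:
  assumes "delta0 M P"
  shows "\<exists>C \<A>. finite C \<and> finite \<A> \<and> \<A> \<subseteq> sets M \<and>
    (\<forall>cn sn \<sigma>. infinite (- range \<sigma>) \<longrightarrow>
      (\<exists>\<phi>. bounded_fm \<phi> \<and> fv \<phi> \<subseteq> range \<sigma> \<union> cn ` C \<and> fv_set \<phi> \<subseteq> sn ` \<A> \<and>
        (\<forall>e E. (\<forall>c\<in>C. e (cn c) = c) \<longrightarrow> (\<forall>A\<in>\<A>. E (sn A) = A) \<longrightarrow>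
          (sat M e E \<phi> \<longleftrightarrow> P (\<lambda>i. e (\<sigma> i))))))"
proof -
  define good where "good C \<A> cn sn \<sigma> P \<phi> \<longleftrightarrow>
      bounded_fm \<phi> \<and> fv \<phi> \<subseteq> range \<sigma> \<union> cn ` C \<and> fv_set \<phi> \<subseteq> sn ` \<A> \<and>
        (\<forall>e E. (\<forall>c\<in>C. e (cn c) = c) \<longrightarrow> (\<forall>A\<in>\<A>. E (sn A) = A) \<longrightarrow>
          (sat M e E \<phi> \<longleftrightarrow> P (\<lambda>i. e (\<sigma> i))))"
    for C \<A> and cn :: "'a \<Rightarrow> string" and sn :: "'a set \<Rightarrow> string" and \<sigma> :: "nat \<Rightarrow> string" and P \<phi>
  define rep where "rep C \<A> P \<longleftrightarrow> finite C \<and> finite \<A> \<and> \<A> \<subseteq> sets M \<and>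
    (\<forall>cn sn \<sigma>. infinite (- range \<sigma>) \<longrightarrow> (\<exists>\<phi>. good C \<A> cn sn \<sigma> P \<phi>))" for C \<A> P
  have atom: "\<exists>C \<A>. rep C \<A> (\<lambda>e. r (s e) (t e))"
    if "term_fun M s" "term_fun M t" and "\<And>u v. bounded_fm (F u v)"
      and "\<And>u v e E. sat M e E (F u v) = r (eval M e u) (eval M e v)"
      and "\<And>u v. fv (F u v) = vars_tm u \<union> vars_tm v" "\<And>u v. fv_set (F u v) = {}" for s t r F
  proof -
    from term_fun_represent[OF that(1)] obtain C where C: "finite C"
      "\<And>cn (\<sigma> :: nat \<Rightarrow> string). \<exists>u. vars_tm u \<subseteq> range \<sigma> \<union> cn ` C \<and>
        (\<forall>e. (\<forall>c\<in>C. e (cn c) = c) \<longrightarrow> eval M e u = s (\<lambda>i. e (\<sigma> i)))" by blast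
    from term_fun_represent[OF that(2)] obtain D where D: "finite D"
      "\<And>cn (\<sigma> :: nat \<Rightarrow> string). \<exists>u. vars_tm u \<subseteq> range \<sigma> \<union> cn ` D \<and>
        (\<forall>e. (\<forall>c\<in>D. e (cn c) = c) \<longrightarrow> eval M e u = t (\<lambda>i. e (\<sigma> i)))" by blast
    have "\<exists>\<phi>. good (C \<union> D) {} cn sn \<sigma> (\<lambda>e. r (s e) (t e)) \<phi>" for cn sn \<sigma>
    proof -
      from C(2)[of \<sigma> cn] D(2)[of \<sigma> cn] obtain u v where
        "vars_tm u \<subseteq> range \<sigma> \<union> cn ` C" "\<forall>e. (\<forall>c\<in>C. e (cn c) = c) \<longrightarrow> eval M e u = s (\<lambda>i. e (\<sigma> i))"
        "vars_tm v \<subseteq> range \<sigma> \<union> cn ` D" "\<forall>e. (\<forall>c\<in>D. e (cn c) = c) \<longrightarrow> eval M e v = t (\<lambda>i. e (\<sigma> i))"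
        by blast
      then show ?thesis unfolding good_def by (intro exI[of _ "F u v"]) (auto simp: that(3-))
    qed
    with C D have "rep (C \<union> D) {} (\<lambda>e. r (s e) (t e))" by (simp add: rep_def)
    then show ?thesis by blast
  qed
  from assms have "\<exists>C \<A>. rep C \<A> P"
  proof induction
    case (eq s t)
    then show ?case by (rule atom[where F=Eq]) (auto intro: bounded_fm.intros)
  next
    case (less s t)
    then show ?case by (rule atom[where F=Less]) (auto intro: bounded_fm.intros)
  next
    case (mem A t)
    from term_fun_represent[OF mem(2)] obtain C where C: "finite C"
      "\<And>cn (\<sigma> :: nat \<Rightarrow> string). \<exists>u. vars_tm u \<subseteq> range \<sigma> \<union> cn ` C \<and>
        (\<forall>e. (\<forall>c\<in>C. e (cn c) = c) \<longrightarrow> eval M e u = t (\<lambda>i. e (\<sigma> i)))" by blast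
    have "\<exists>\<phi>. good C {A} cn sn \<sigma> (\<lambda>e. t e \<in> A) \<phi>" for cn sn \<sigma>
    proof -
      from C(2)[of \<sigma> cn] obtain u where
        "vars_tm u \<subseteq> range \<sigma> \<union> cn ` C" "\<forall>e. (\<forall>c\<in>C. e (cn c) = c) \<longrightarrow> eval M e u = t (\<lambda>i. e (\<sigma> i))"
        by blast
      then show ?thesis unfolding good_def
        by (intro exI[of _ "u \<^bold>\<in> sn A"]) (auto intro: bounded_fm.intros)
    qed
    with C mem have "rep C {A} (\<lambda>e. t e \<in> A)" by (simp add: rep_def)
    then show ?case by blast
  next
    case (neg P)
    then obtain C \<A> where rep: "rep C \<A> P" by blast
    have "\<exists>\<phi>. good C \<A> cn sn \<sigma> (\<lambda>e. \<not> P e) \<phi>" if inf: "infinite (- range \<sigma>)" for cn sn \<sigma>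
    proof -
      from rep inf obtain \<phi> where "good C \<A> cn sn \<sigma> P \<phi>" unfolding rep_def by blast
      then show ?thesis unfolding good_def
        by (intro exI[of _ "\<^bold>\<not> \<phi>"]) (auto intro: bounded_fm.intros)
    qed
    with rep have "rep C \<A> (\<lambda>e. \<not> P e)" by (simp add: rep_def)
    then show ?case by blast
  next
    case (conj P Q)
    then obtain C \<A> D \<B> where rep: "rep C \<A> P" "rep D \<B> Q" by blast
    have "\<exists>\<phi>. good (C \<union> D) (\<A> \<union> \<B>) cn sn \<sigma> (\<lambda>e. P e \<and> Q e) \<phi>"
      if inf: "infinite (- range \<sigma>)" for cn sn \<sigma>
    proof -
      from rep inf obtain \<phi> \<psi> where "good C \<A> cn sn \<sigma> P \<phi>" "good D \<B> cn sn \<sigma> Q \<psi>"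
        unfolding rep_def by blast
      then show ?thesis unfolding good_def
        by (intro exI[of _ "\<phi> \<^bold>\<and> \<psi>"]) (auto intro: bounded_fm.intros)
    qed
    with rep have "rep (C \<union> D) (\<A> \<union> \<B>) (\<lambda>e. P e \<and> Q e)" by (simp add: rep_def)
    then show ?case by blast
  next
    case (bex t Q)
    then obtain C \<A> where rep: "rep C \<A> (\<lambda>e. Q (\<lambda>i. e (Suc i)) (e 0))" by blast
    from term_fun_represent[OF bex(1)] obtain D where D: "finite D"
      "\<And>cn (\<sigma> :: nat \<Rightarrow> string). \<exists>u. vars_tm u \<subseteq> range \<sigma> \<union> cn ` D \<and>
        (\<forall>e. (\<forall>c\<in>D. e (cn c) = c) \<longrightarrow> eval M e u = t (\<lambda>i. e (\<sigma> i)))" by blast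
    have "\<exists>\<phi>. good (C \<union> D) \<A> cn sn \<sigma> (\<lambda>e. \<exists>x. structure2.less M x (t e) \<and> Q e x) \<phi>"
      if inf: "infinite (- range \<sigma>)" for cn sn \<sigma>
    proof -
      have fin: "finite (cn ` (C \<union> D))" using D rep by (simp add: rep_def)
      then have "infinite (- range \<sigma> - cn ` (C \<union> D))" using inf by simp
      then obtain x where x: "x \<notin> range \<sigma>" "x \<notin> cn ` (C \<union> D)"
        by (metis Diff_iff ComplD finite.emptyI ex_in_conv)
      \<comment> \<open>The fresh name \<open>x\<close> is pushed as the name of the new index
        0.\<close>
      define \<sigma>' where "\<sigma>' = case_nat x \<sigma>"
      have \<sigma>': "range \<sigma>' = insert x (range \<sigma>)"
        unfolding \<sigma>'_def by (auto simp: image_iff split: nat.splits)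
      have "- range \<sigma>' = - range \<sigma> - {x}" using \<sigma>' by auto
      then have "infinite (- range \<sigma>')" using inf by simp
      with rep obtain \<phi> where \<phi>: "good C \<A> cn sn \<sigma>' (\<lambda>e. Q (\<lambda>i. e (Suc i)) (e 0)) \<phi>"
        unfolding rep_def by blast
      from D(2)[of \<sigma> cn] obtain u where
        u: "vars_tm u \<subseteq> range \<sigma> \<union> cn ` D" "\<forall>e. (\<forall>c\<in>D. e (cn c) = c) \<longrightarrow> eval M e u = t (\<lambda>i. e (\<sigma> i))"
        by blast
      have xu: "x \<notin> vars_tm u" using u x by auto
      have "eval M (e(x := a)) u = eval M e u" for e a using xu by (intro eval_cong) auto
      moreover have "(\<lambda>i. (e(x := a)) (\<sigma> i)) = (\<lambda>i. e (\<sigma> i))" for e :: "string \<Rightarrow> 'a" and a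
        using x by (intro ext) auto
      moreover have "\<forall>c\<in>C \<union> D. cn c \<noteq> x" using x by auto
      ultimately have "good (C \<union> D) \<A> cn sn \<sigma> (\<lambda>e. \<exists>x. structure2.less M x (t e) \<and> Q e x)
          (\<^bold>\<exists>x. Var x \<^bold>< u \<^bold>\<and> \<phi>)"
        using \<phi> u xu unfolding good_def \<sigma>'
        by (auto intro!: bounded_fm.intros simp: \<sigma>'_def)
      then show ?thesis ..
    qed
    with rep D have "rep (C \<union> D) \<A> (\<lambda>e. \<exists>x. structure2.less M x (t e) \<and> Q e x)" by (simp add: rep_def)
    then show ?case by blast
  qed
  then show ?thesis unfolding rep_def good_def .
qed

section \<open>Sigma_1 predicates and their formulas\<close>

definition sigma1 :: "'a structure2 \<Rightarrow> ((nat \<Rightarrow> 'a) \<Rightarrow> bool) \<Rightarrow> bool" where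
  "sigma1 M P \<longleftrightarrow> (\<exists>R. delta0 M R \<and> (\<forall>e. P e \<longleftrightarrow> (\<exists>x. R (case_nat x e))))"

lemma sigma1_ex_delta0:
  "delta0 M (\<lambda>e. Q (\<lambda>i. e (Suc i)) (e 0)) \<Longrightarrow> sigma1 M (\<lambda>e. \<exists>x. Q e x)"
  unfolding sigma1_def by (intro exI[of _ "\<lambda>e. Q (\<lambda>i. e (Suc i)) (e 0)"]) auto

lemma sigma1_delta0: "delta0 M P \<Longrightarrow> sigma1 M P"
  using sigma1_ex_delta0[of M "\<lambda>e x. P e"] delta0_subst[of M P "\<lambda>i e. e (Suc i)"]
  by (simp add: term_fun.var)

lemma sigma1_subst:
  assumes "sigma1 M P" "\<And>i. term_fun M (\<tau> i)"
  shows "sigma1 M (\<lambda>e. P (\<lambda>i. \<tau> i e))"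
proof -
  obtain R where R: "delta0 M R" "\<And>e. P e \<longleftrightarrow> (\<exists>x. R (case_nat x e))"
    using assms(1) unfolding sigma1_def by blast
  define \<tau>' where "\<tau>' i = (case i of 0 \<Rightarrow> (\<lambda>e. e 0) | Suc j \<Rightarrow> (\<lambda>e. \<tau> j (\<lambda>i. e (Suc i))))" for i
  have "term_fun M (\<tau>' i)" for i
    by (cases i) (auto simp: \<tau>'_def intro: term_fun.var term_fun_shift assms(2))
  then have d: "delta0 M (\<lambda>e. R (\<lambda>i. \<tau>' i e))" by (rule delta0_subst[OF R(1)])
  have "(\<lambda>i. \<tau>' i (case_nat x e)) = case_nat x (\<lambda>i. \<tau> i e)" for x e
    by (rule ext) (auto simp: \<tau>'_def split: nat.splits)
  then show ?thesis unfolding sigma1_def using d R(2) by (intro exI[of _ "\<lambda>e. R (\<lambda>i. \<tau>' i e)"]) simp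
qed

lemma sigma1_subst1:
  assumes "sigma1 M (\<lambda>e. P (e 0))" "term_fun M s"
  shows "sigma1 M (\<lambda>e. P (s e))"
  using sigma1_subst[OF assms(1), of "\<lambda>_. s"] assms(2) by simp

lemma sigma1_subst2:
  assumes "sigma1 M (\<lambda>e. P (e 0) (e 1))" "term_fun M s" "term_fun M t"
  shows "sigma1 M (\<lambda>e. P (s e) (t e))"
  using sigma1_subst[OF assms(1), of "\<lambda>i. if i = 0 then s else t"] assms(2,3) by simp

text \<open>Supplies the instances of induction and comprehension. Both matrices share one valuation
  of their parameters, and the equivalences survive changes at the names that the axioms
  bind.\<close>

lemma delta0_pair_formulas:
  assumes "delta0 M R" "delta0 M S" "sets M \<noteq> {}"
  obtains \<phi> \<psi> e E where "bounded_fm \<phi>" "bounded_fm \<psi>" "\<And>X. E X \<in> sets M"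
    "''n'' \<notin> fv \<phi>" "''X'' \<notin> fv_set \<phi>"
    "\<And>e' E'. \<forall>s. s \<notin> {''x'', ''y'', ''n''} \<longrightarrow> e' s = e s \<Longrightarrow> \<forall>s. s \<noteq> ''X'' \<longrightarrow> E' s = E s \<Longrightarrow>
      sat M e' E' \<phi> \<longleftrightarrow> R (case_nat (e' ''y'') (\<lambda>_. e' ''x''))"
    "\<And>e' E'. \<forall>s. s \<notin> {''x'', ''y'', ''n''} \<longrightarrow> e' s = e s \<Longrightarrow> \<forall>s. s \<noteq> ''X'' \<longrightarrow> E' s = E s \<Longrightarrow>
      sat M e' E' \<psi> \<longleftrightarrow> S (case_nat (e' ''y'') (\<lambda>_. e' ''x''))"
proof -
  obtain C1 A1 where 1: "finite C1" "finite A1" "A1 \<subseteq> sets M"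
    and R: "\<forall>cn sn \<sigma>. infinite (- range \<sigma>) \<longrightarrow>
      (\<exists>\<phi>. bounded_fm \<phi> \<and> fv \<phi> \<subseteq> range \<sigma> \<union> cn ` C1 \<and> fv_set \<phi> \<subseteq> sn ` A1 \<and>
        (\<forall>e E. (\<forall>c\<in>C1. e (cn c) = c) \<longrightarrow> (\<forall>A\<in>A1. E (sn A) = A) \<longrightarrow>
          (sat M e E \<phi> \<longleftrightarrow> R (\<lambda>i. e (\<sigma> i)))))"
    using delta0_represent[OF assms(1)] by (elim exE conjE)
  obtain C2 A2 where 2: "finite C2" "finite A2" "A2 \<subseteq> sets M"
    and S: "\<forall>cn sn \<sigma>. infinite (- range \<sigma>) \<longrightarrow>
      (\<exists>\<phi>. bounded_fm \<phi> \<and> fv \<phi> \<subseteq> range \<sigma> \<union> cn ` C2 \<and> fv_set \<phi> \<subseteq> sn ` A2 \<and>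
        (\<forall>e E. (\<forall>c\<in>C2. e (cn c) = c) \<longrightarrow> (\<forall>A\<in>A2. E (sn A) = A) \<longrightarrow>
          (sat M e E \<phi> \<longleftrightarrow> S (\<lambda>i. e (\<sigma> i)))))"
    using delta0_represent[OF assms(2)] by (elim exE conjE)
  define C where "C = C1 \<union> C2"
  define A where "A = A1 \<union> A2"
  have fin: "finite C" "finite A" "A \<subseteq> sets M" using 1 2 by (auto simp: C_def A_def)
  from finite_imp_inj_to_nat_seg[OF fin(1)] obtain c :: "'a \<Rightarrow> nat" where c: "inj_on c C" by blast
  from finite_imp_inj_to_nat_seg[OF fin(2)] obtain d :: "'a set \<Rightarrow> nat" where d: "inj_on d A" by blast
  \<comment> \<open>Parameter names are nonempty strings of the letter c, told apart by their
    length, hence different from the four names reserved for the axioms.\<close>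
  define cn where "cn x = CHR ''c'' # replicate (c x) CHR ''c''" for x
  define sn where "sn x = CHR ''c'' # replicate (d x) CHR ''c''" for x
  have cn: "inj_on cn C" and sn: "inj_on sn A" using c d by (auto simp: cn_def sn_def inj_on_def)
  \<comment> \<open>Index 0 is the unbounded quantifier in front of the matrix; all other indices
    are read as the one argument \<open>x\<close>.\<close>
  define \<sigma> :: "nat \<Rightarrow> string" where "\<sigma> = case_nat ''y'' (\<lambda>_. ''x'')"
  have ran: "range \<sigma> \<subseteq> {''x'', ''y''}" by (auto simp: \<sigma>_def split: nat.splits)
  then have "finite (range \<sigma>)" by (rule finite_subset) simp
  then have inf: "infinite (- range \<sigma>)" using infinite_UNIV_listI by (metis finite_compl)
  from R[rule_format, OF this, of cn sn] obtain \<phi> where \<phi>: "bounded_fm \<phi>" "fv \<phi> \<subseteq> range \<sigma> \<union> cn ` C1" "fv_set \<phi> \<subseteq> sn ` A1"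
        "\<forall>e E. (\<forall>c\<in>C1. e (cn c) = c) \<longrightarrow> (\<forall>A\<in>A1. E (sn A) = A) \<longrightarrow>
          (sat M e E \<phi> \<longleftrightarrow> R (\<lambda>i. e (\<sigma> i)))" by blast
  from S[rule_format, OF inf, of cn sn] obtain \<psi> where \<psi>: "bounded_fm \<psi>"
        "\<forall>e E. (\<forall>c\<in>C2. e (cn c) = c) \<longrightarrow> (\<forall>A\<in>A2. E (sn A) = A) \<longrightarrow>
          (sat M e E \<psi> \<longleftrightarrow> S (\<lambda>i. e (\<sigma> i)))" by blast
  define e where "e s = (if s \<in> cn ` C then inv_into C cn s else zero M)" for s
  define E where "E s = (if s \<in> sn ` A then inv_into A sn s else (SOME A. A \<in> sets M))" for s
  have e: "e (cn c) = c" if "c \<in> C" for c using that cn by (simp add: e_def)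
  have E: "E (sn B) = B" if "B \<in> A" for B using that sn by (simp add: E_def)
  have "E X \<in> sets M" for X
    using assms(3) fin(3) sn by (auto simp: E_def some_in_eq)
  moreover have "''n'' \<notin> fv \<phi>" using \<phi>(2) ran by (auto simp: cn_def)
  moreover have "''X'' \<notin> fv_set \<phi>" using \<phi>(3) by (auto simp: sn_def)
  moreover have cn_neq: "cn c \<notin> {''x'', ''y'', ''n''}" "sn B \<noteq> ''X''" for c B by (auto simp: cn_def sn_def)
  moreover have \<sigma>: "(\<lambda>i. e (\<sigma> i)) = case_nat (e ''y'') (\<lambda>_. e ''x'')" for e :: "string \<Rightarrow> 'a"
    by (rule ext) (auto simp: \<sigma>_def split: nat.splits)
  ultimately show ?thesis
    using \<phi>(1,4) \<psi> e E by (intro that[of \<phi> \<psi> E e]) (auto simp: C_def A_def \<sigma>)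
qed

definition leq :: "'a structure2 \<Rightarrow> 'a \<Rightarrow> 'a \<Rightarrow> bool" where
  "leq M a b \<longleftrightarrow> less M a b \<or> a = b"

definition pair :: "'a structure2 \<Rightarrow> 'a \<Rightarrow> 'a \<Rightarrow> 'a" where
  "pair M s t = plus M (times M (plus M s t) (plus M s t)) s"

lemma term_fun_pair:
  "term_fun M s \<Longrightarrow> term_fun M t \<Longrightarrow> term_fun M (\<lambda>e. pair M (s e) (t e))"
  unfolding pair_def by (intro term_fun.intros)

lemma delta0_leq: "term_fun M s \<Longrightarrow> term_fun M t \<Longrightarrow> delta0 M (\<lambda>e. leq M (s e) (t e))"
  unfolding leq_def by (intro delta0.intros delta0_disj)

section \<open>Axioms, induction and comprehension in a model\<close>

locale rca0_model =
  fixes M :: "'a structure2"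
  assumes RCA0: "M \<^bold>\<Turnstile> RCA0"
begin

abbreviation zero_M ("\<zero>") where "\<zero> \<equiv> zero M"
abbreviation one_M ("\<one>") where "\<one> \<equiv> one M"
abbreviation plus_M (infixl "\<oplus>" 65) where "a \<oplus> b \<equiv> plus M a b"
abbreviation times_M (infixl "\<otimes>" 70) where "a \<otimes> b \<equiv> times M a b"
abbreviation less_M (infix "\<prec>" 50) where "a \<prec> b \<equiv> less M a b"
abbreviation leq_M (infix "\<preceq>" 50) where "a \<preceq> b \<equiv> leq M a b"
abbreviation pair_M ("\<langle>_,/ _\<rangle>") where "\<langle>a, b\<rangle> \<equiv> pair M a b"

lemma sets_nonempty: "sets M \<noteq> {}"
  using RCA0 by (simp add: models_def)

lemma RCA0_sat: "\<phi> \<in> RCA0 \<Longrightarrow> (\<And>X. E X \<in> sets M) \<Longrightarrow> sat M e E \<phi>"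
  using RCA0 by (simp add: models_def)

lemma basic_sat: "\<phi> \<in> basic_axioms \<Longrightarrow> sat M e (\<lambda>_. SOME A. A \<in> sets M) \<phi>"
  by (rule RCA0_sat) (auto simp: RCA0_def some_in_eq sets_nonempty)

lemma
  shows suc_neq_zero: "n \<oplus> \<one> \<noteq> \<zero>"
    and suc_inject: "m \<oplus> \<one> = n \<oplus> \<one> \<Longrightarrow> m = n"
    and add_zero: "m \<oplus> \<zero> = m"
    and add_suc: "m \<oplus> (n \<oplus> \<one>) = (m \<oplus> n) \<oplus> \<one>"
    and mult_zero: "m \<otimes> \<zero> = \<zero>"
    and mult_suc: "m \<otimes> (n \<oplus> \<one>) = (m \<otimes> n) \<oplus> m"
    and not_less_zero: "\<not> m \<prec> \<zero>"
    and less_suc: "m \<prec> n \<oplus> \<one> \<longleftrightarrow> m \<prec> n \<or> m = n"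
proof -
  let ?e = "(\<lambda>_. \<zero>)(''m'' := m, ''n'' := n)" and ?m = "Var ''m''" and ?n = "Var ''n''"
  have "sat M ?e (\<lambda>_. SOME A. A \<in> sets M) \<phi>"
    if "\<phi> \<in> {\<^bold>\<not> (?n \<^bold>+ One \<^bold>= Zero), ?m \<^bold>+ One \<^bold>= ?n \<^bold>+ One \<^bold>\<longrightarrow> ?m \<^bold>= ?n,
       ?m \<^bold>+ Zero \<^bold>= ?m, ?m \<^bold>+ (?n \<^bold>+ One) \<^bold>= (?m \<^bold>+ ?n) \<^bold>+ One, ?m \<^bold>* Zero \<^bold>= Zero,
       ?m \<^bold>* (?n \<^bold>+ One) \<^bold>= (?m \<^bold>* ?n) \<^bold>+ ?m, \<^bold>\<not> (?m \<^bold>< Zero),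
       ?m \<^bold>< ?n \<^bold>+ One \<^bold>\<longleftrightarrow> (?m \<^bold>< ?n \<^bold>\<or> ?m \<^bold>= ?n)}" for \<phi>
    using basic_sat[of \<phi> ?e] that unfolding basic_axioms_def Let_def .
  then have "\<forall>\<phi>\<in>{\<^bold>\<not> (?n \<^bold>+ One \<^bold>= Zero), ?m \<^bold>+ One \<^bold>= ?n \<^bold>+ One \<^bold>\<longrightarrow> ?m \<^bold>= ?n,
       ?m \<^bold>+ Zero \<^bold>= ?m, ?m \<^bold>+ (?n \<^bold>+ One) \<^bold>= (?m \<^bold>+ ?n) \<^bold>+ One, ?m \<^bold>* Zero \<^bold>= Zero,
       ?m \<^bold>* (?n \<^bold>+ One) \<^bold>= (?m \<^bold>* ?n) \<^bold>+ ?m, \<^bold>\<not> (?m \<^bold>< Zero),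
       ?m \<^bold>< ?n \<^bold>+ One \<^bold>\<longleftrightarrow> (?m \<^bold>< ?n \<^bold>\<or> ?m \<^bold>= ?n)}. sat M ?e (\<lambda>_. SOME A. A \<in> sets M) \<phi>" by blast
  then show "n \<oplus> \<one> \<noteq> \<zero>" "m \<oplus> \<one> = n \<oplus> \<one> \<Longrightarrow> m = n" "m \<oplus> \<zero> = m"
    "m \<oplus> (n \<oplus> \<one>) = (m \<oplus> n) \<oplus> \<one>" "m \<otimes> \<zero> = \<zero>" "m \<otimes> (n \<oplus> \<one>) = (m \<otimes> n) \<oplus> m"
    "\<not> m \<prec> \<zero>" "m \<prec> n \<oplus> \<one> \<longleftrightarrow> m \<prec> n \<or> m = n"
    by simp_all
qed

lemma sigma1_induct:
  assumes "sigma1 M (\<lambda>e. P (e 0))" "P \<zero>" "\<And>n. P n \<Longrightarrow> P (n \<oplus> \<one>)"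
  shows "P n"
proof -
  from assms(1) obtain R where R: "delta0 M R" "\<And>e. P (e 0) \<longleftrightarrow> (\<exists>x. R (case_nat x e))"
    unfolding sigma1_def by blast
  obtain \<phi> \<psi> e E where \<phi>: "bounded_fm \<phi>" "bounded_fm \<psi>" "\<And>X. E X \<in> sets M" "''n'' \<notin> fv \<phi>" "''X'' \<notin> fv_set \<phi>"
    "\<And>e' E'. \<forall>s. s \<notin> {''x'', ''y'', ''n''} \<longrightarrow> e' s = e s \<Longrightarrow> \<forall>s. s \<noteq> ''X'' \<longrightarrow> E' s = E s \<Longrightarrow>
      sat M e' E' \<phi> \<longleftrightarrow> R (case_nat (e' ''y'') (\<lambda>_. e' ''x''))"
    "\<And>e' E'. \<forall>s. s \<notin> {''x'', ''y'', ''n''} \<longrightarrow> e' s = e s \<Longrightarrow> \<forall>s. s \<noteq> ''X'' \<longrightarrow> E' s = E s \<Longrightarrow>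
      sat M e' E' \<psi> \<longleftrightarrow> R (case_nat (e' ''y'') (\<lambda>_. e' ''x''))"
    by (rule delta0_pair_formulas[OF R(1) R(1) sets_nonempty]) (rule that)
  have P: "P m \<longleftrightarrow> (\<exists>x. R (case_nat x (\<lambda>_. m)))" for m using R(2)[of "\<lambda>_. m"] .
  \<comment> \<open>Two shapes of environment occur: in the induction step the name \<open>n\<close>
    has been overwritten, in the base case and the conclusion it has not.\<close>
  have *: "(\<exists>y. sat M (e(''n'' := k, ''x'' := m, ''y'' := y)) E \<phi>) \<longleftrightarrow> P m"
    "(\<exists>y. sat M (e(''x'' := m, ''y'' := y)) E \<phi>) \<longleftrightarrow> P m" for k m
    unfolding P by (subst \<phi>(6); simp)+
  let ?\<phi> = "inst (\<^bold>\<exists>''y''. \<phi>) ''x'' Zero \<^bold>\<and>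
    (\<^bold>\<forall>''n''. inst (\<^bold>\<exists>''y''. \<phi>) ''x'' (Var ''n'') \<^bold>\<longrightarrow> inst (\<^bold>\<exists>''y''. \<phi>) ''x'' (Var ''n'' \<^bold>+ One)) \<^bold>\<longrightarrow>
    (\<^bold>\<forall>''x''. \<^bold>\<exists>''y''. \<phi>)"
  have "sat M e E ?\<phi>"
    using \<phi> by (intro RCA0_sat)
     (auto simp: RCA0_def Sigma01_induction_def Sigma01_def intro!: exI[of _ "\<^bold>\<exists>''y''. \<phi>"] exI[of _ "''x''"] exI[of _ "''n''"])
  moreover have "sat M e E ?\<phi> \<longleftrightarrow> (P \<zero> \<and> (\<forall>n. P n \<longrightarrow> P (n \<oplus> \<one>)) \<longrightarrow> (\<forall>n. P n))"
    by (simp add: inst_def *)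
  moreover have "P \<zero> \<and> (\<forall>n. P n \<longrightarrow> P (n \<oplus> \<one>))" using assms(2,3) by blast
  ultimately show ?thesis by blast
qed

lemma delta0_induct:
  assumes "delta0 M (\<lambda>e. P (e 0))" "P \<zero>" "\<And>n. P n \<Longrightarrow> P (n \<oplus> \<one>)"
  shows "P n"
  by (rule sigma1_induct[of P, OF sigma1_delta0[OF assms(1)] assms(2,3)])

lemma delta1_comprehension:
  assumes "sigma1 M (\<lambda>e. P (e 0))" "sigma1 M (\<lambda>e. \<not> P (e 0))"
  shows "Collect P \<in> sets M"
proof -
  from assms obtain R S where R: "delta0 M R" "\<And>e. P (e 0) \<longleftrightarrow> (\<exists>x. R (case_nat x e))"
    and S: "delta0 M S" "\<And>e. \<not> P (e 0) \<longleftrightarrow> (\<exists>x. S (case_nat x e))"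
    unfolding sigma1_def by blast
  obtain \<phi> \<psi> e E where \<phi>: "bounded_fm \<phi>" "bounded_fm \<psi>" "\<And>X. E X \<in> sets M" "''n'' \<notin> fv \<phi>" "''X'' \<notin> fv_set \<phi>"
    "\<And>e' E'. \<forall>s. s \<notin> {''x'', ''y'', ''n''} \<longrightarrow> e' s = e s \<Longrightarrow> \<forall>s. s \<noteq> ''X'' \<longrightarrow> E' s = E s \<Longrightarrow>
      sat M e' E' \<phi> \<longleftrightarrow> R (case_nat (e' ''y'') (\<lambda>_. e' ''x''))"
    "\<And>e' E'. \<forall>s. s \<notin> {''x'', ''y'', ''n''} \<longrightarrow> e' s = e s \<Longrightarrow> \<forall>s. s \<noteq> ''X'' \<longrightarrow> E' s = E s \<Longrightarrow>
      sat M e' E' \<psi> \<longleftrightarrow> \<not> S (case_nat (e' ''y'') (\<lambda>_. e' ''x''))"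
    \<comment> \<open>The complement is given by \<open>\<exists>y. S\<close>, so the Pi_1 formula
      of the axiom has the negation of \<open>S\<close> as its matrix.\<close>
    by (rule delta0_pair_formulas[OF R(1) delta0.neg[OF S(1)] sets_nonempty]) (rule that)
  have P: "P m \<longleftrightarrow> (\<exists>x. R (case_nat x (\<lambda>_. m)))" for m using R(2)[of "\<lambda>_. m"] .
  have P': "P m \<longleftrightarrow> (\<forall>x. \<not> S (case_nat x (\<lambda>_. m)))" for m using S(2)[of "\<lambda>_. m"] by blast
  have *: "(\<exists>y. sat M (e(''x'' := m, ''y'' := y)) E \<phi>) \<longleftrightarrow> P m"
    "(\<exists>y. sat M (e(''x'' := m, ''y'' := y)) (E(''X'' := A)) \<phi>) \<longleftrightarrow> P m" for A m
    unfolding P by (subst \<phi>(6); simp)+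
  have **: "(\<forall>y. sat M (e(''x'' := m, ''y'' := y)) E \<psi>) \<longleftrightarrow> P m" for m
    unfolding P' by (subst \<phi>(7); simp)
  have "sat M e E ((\<^bold>\<forall>''x''. (\<^bold>\<exists>''y''. \<phi>) \<^bold>\<longleftrightarrow> (\<^bold>\<forall>''y''. \<psi>)) \<^bold>\<longrightarrow>
      (\<^bold>\<exists>\<^sub>2''X''. \<^bold>\<forall>''x''. Var ''x'' \<^bold>\<in> ''X'' \<^bold>\<longleftrightarrow> (\<^bold>\<exists>''y''. \<phi>)))"
    using \<phi> by (intro RCA0_sat)
      (auto simp: RCA0_def Delta01_comprehension_def Sigma01_def Pi01_def)
  then have "\<exists>A\<in>sets M. \<forall>x. x \<in> A \<longleftrightarrow> P x" by (simp add: * **)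
  then obtain A where "A \<in> sets M" "\<forall>x. x \<in> A \<longleftrightarrow> P x" by blast
  then have "A = Collect P" by auto
  then show ?thesis using \<open>A \<in> sets M\<close> by simp
qed

lemma delta0_comprehension:
  assumes "delta0 M (\<lambda>e. P (e 0))"
  shows "Collect P \<in> sets M"
  by (intro delta1_comprehension sigma1_delta0 delta0.neg assms)

end

lemmas delta0_rules =
  delta0.intros delta0_disj delta0_imp delta0_iff delta0_ball delta0_leq term_fun_pair term_fun.intros

section \<open>The ordered semiring of the model\<close>

context rca0_model
begin

lemma zero_add: "\<zero> \<oplus> n = n"
proof (rule delta0_induct[of "\<lambda>n. \<zero> \<oplus> n = n"])
  show "delta0 M (\<lambda>e. \<zero> \<oplus> e 0 = e 0)" by (intro delta0_rules)
qed (simp_all add: add_zero add_suc)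

lemma suc_add: "(m \<oplus> \<one>) \<oplus> n = (m \<oplus> n) \<oplus> \<one>"
proof (rule delta0_induct[of "\<lambda>n. (m \<oplus> \<one>) \<oplus> n = (m \<oplus> n) \<oplus> \<one>"])
  show "delta0 M (\<lambda>e. (m \<oplus> \<one>) \<oplus> e 0 = (m \<oplus> e 0) \<oplus> \<one>)" by (intro delta0_rules)
qed (simp_all add: add_zero add_suc)

lemma add_commute: "m \<oplus> n = n \<oplus> m"
proof (rule delta0_induct[of "\<lambda>n. m \<oplus> n = n \<oplus> m"])
  show "delta0 M (\<lambda>e. m \<oplus> e 0 = e 0 \<oplus> m)" by (intro delta0_rules)
qed (simp_all add: add_zero zero_add add_suc suc_add)

lemma add_assoc: "(m \<oplus> n) \<oplus> k = m \<oplus> (n \<oplus> k)"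
proof (rule delta0_induct[of "\<lambda>k. (m \<oplus> n) \<oplus> k = m \<oplus> (n \<oplus> k)"])
  show "delta0 M (\<lambda>e. (m \<oplus> n) \<oplus> e 0 = m \<oplus> (n \<oplus> e 0))" by (intro delta0_rules)
qed (simp_all add: add_zero add_suc)

lemma zero_mult: "\<zero> \<otimes> n = \<zero>"
proof (rule delta0_induct[of "\<lambda>n. \<zero> \<otimes> n = \<zero>"])
  show "delta0 M (\<lambda>e. \<zero> \<otimes> e 0 = \<zero>)" by (intro delta0_rules)
qed (simp_all add: mult_zero mult_suc add_zero)

lemma add_left_commute: "m \<oplus> (n \<oplus> k) = n \<oplus> (m \<oplus> k)"
  by (metis add_commute add_assoc)

lemma suc_mult: "(m \<oplus> \<one>) \<otimes> n = (m \<otimes> n) \<oplus> n"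
proof (rule delta0_induct[of "\<lambda>n. (m \<oplus> \<one>) \<otimes> n = (m \<otimes> n) \<oplus> n"])
  show "delta0 M (\<lambda>e. (m \<oplus> \<one>) \<otimes> e 0 = (m \<otimes> e 0) \<oplus> e 0)" by (intro delta0_rules)
  fix n assume "(m \<oplus> \<one>) \<otimes> n = m \<otimes> n \<oplus> n"
  then show "(m \<oplus> \<one>) \<otimes> (n \<oplus> \<one>) = m \<otimes> (n \<oplus> \<one>) \<oplus> (n \<oplus> \<one>)"
    by (simp add: mult_suc add_assoc add_left_commute add_commute)
qed (simp_all add: mult_zero add_zero)

lemma mult_commute: "m \<otimes> n = n \<otimes> m"
proof (rule delta0_induct[of "\<lambda>n. m \<otimes> n = n \<otimes> m"])
  show "delta0 M (\<lambda>e. m \<otimes> e 0 = e 0 \<otimes> m)" by (intro delta0_rules)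
qed (simp_all add: mult_zero zero_mult mult_suc suc_mult)

lemma distrib: "m \<otimes> (n \<oplus> k) = m \<otimes> n \<oplus> m \<otimes> k"
proof (rule delta0_induct[of "\<lambda>k. m \<otimes> (n \<oplus> k) = m \<otimes> n \<oplus> m \<otimes> k"])
  show "delta0 M (\<lambda>e. m \<otimes> (n \<oplus> e 0) = m \<otimes> n \<oplus> m \<otimes> e 0)" by (intro delta0_rules)
  fix k assume "m \<otimes> (n \<oplus> k) = m \<otimes> n \<oplus> m \<otimes> k"
  then show "m \<otimes> (n \<oplus> (k \<oplus> \<one>)) = m \<otimes> n \<oplus> m \<otimes> (k \<oplus> \<one>)"
    by (simp only: mult_suc add_assoc[symmetric])
qed (simp_all add: mult_zero add_zero)

lemma mult_assoc: "(m \<otimes> n) \<otimes> k = m \<otimes> (n \<otimes> k)"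
proof (rule delta0_induct[of "\<lambda>k. (m \<otimes> n) \<otimes> k = m \<otimes> (n \<otimes> k)"])
  show "delta0 M (\<lambda>e. (m \<otimes> n) \<otimes> e 0 = m \<otimes> (n \<otimes> e 0))" by (intro delta0_rules)
  show "m \<otimes> n \<otimes> k = m \<otimes> (n \<otimes> k) \<Longrightarrow> m \<otimes> n \<otimes> (k \<oplus> \<one>) = m \<otimes> (n \<otimes> (k \<oplus> \<one>))" for k
    by (simp only: mult_suc distrib[of m])
qed (simp_all add: mult_zero)

lemma one_mult: "\<one> \<otimes> n = n"
  using suc_mult[of \<zero> n] by (simp add: zero_mult zero_add)

lemma mult_one: "n \<otimes> \<one> = n"
  using one_mult by (simp add: mult_commute)

lemma add_left_cancel': "m \<oplus> n = m \<oplus> k \<longrightarrow> n = k"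
proof (rule delta0_induct[of "\<lambda>m. m \<oplus> n = m \<oplus> k \<longrightarrow> n = k"])
  show "delta0 M (\<lambda>e. e 0 \<oplus> n = e 0 \<oplus> k \<longrightarrow> n = k)" by (intro delta0_rules)
  fix m assume "m \<oplus> n = m \<oplus> k \<longrightarrow> n = k"
  then show "m \<oplus> \<one> \<oplus> n = m \<oplus> \<one> \<oplus> k \<longrightarrow> n = k" by (auto simp: suc_add dest!: suc_inject)
qed (simp_all add: zero_add)

lemma zero_or_suc: "n = \<zero> \<or> (\<exists>m. n = m \<oplus> \<one>)"
proof (rule sigma1_induct[of "\<lambda>n. n = \<zero> \<or> (\<exists>m. n = m \<oplus> \<one>)"])
  \<comment> \<open>The quantifier is pulled to the front, the shape that
    \<open>sigma1_ex_delta0\<close> recognises.\<close>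
  have "sigma1 M (\<lambda>e. \<exists>m. e 0 = \<zero> \<or> e 0 = m \<oplus> \<one>)" by (intro sigma1_ex_delta0 delta0_rules)
  then show "sigma1 M (\<lambda>e. e 0 = \<zero> \<or> (\<exists>m. e 0 = m \<oplus> \<one>))" by simp
qed auto

text \<open>The axioms tie the primitive order to the successor only; once it is identified with the
  additive order, the order laws follow from those of addition.\<close>

lemma less_iff_add: "a \<prec> b \<longleftrightarrow> (\<exists>c. b = a \<oplus> (c \<oplus> \<one>))"
proof
  have "a \<prec> b \<longrightarrow> (\<exists>c. b = a \<oplus> (c \<oplus> \<one>))"
  proof (rule sigma1_induct[of "\<lambda>b. a \<prec> b \<longrightarrow> (\<exists>c. b = a \<oplus> (c \<oplus> \<one>))"])
    have "sigma1 M (\<lambda>e. \<exists>c. a \<prec> e 0 \<longrightarrow> e 0 = a \<oplus> (c \<oplus> \<one>))" by (intro sigma1_ex_delta0 delta0_rules)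
    then show "sigma1 M (\<lambda>e. a \<prec> e 0 \<longrightarrow> (\<exists>c. e 0 = a \<oplus> (c \<oplus> \<one>)))" by simp
    show "a \<prec> \<zero> \<longrightarrow> (\<exists>c. \<zero> = a \<oplus> (c \<oplus> \<one>))" by (simp add: not_less_zero)
    fix b assume IH: "a \<prec> b \<longrightarrow> (\<exists>c. b = a \<oplus> (c \<oplus> \<one>))"
    show "a \<prec> b \<oplus> \<one> \<longrightarrow> (\<exists>c. b \<oplus> \<one> = a \<oplus> (c \<oplus> \<one>))"
    proof
      assume "a \<prec> b \<oplus> \<one>"
      then consider "a \<prec> b" | "a = b" by (auto simp: less_suc)
      then show "\<exists>c. b \<oplus> \<one> = a \<oplus> (c \<oplus> \<one>)"
      proof cases
        case 1
        with IH show ?thesis by (metis add_assoc)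
      next
        case 2
        then show ?thesis by (metis zero_add)
      qed
    qed
  qed
  then show "a \<prec> b \<Longrightarrow> \<exists>c. b = a \<oplus> (c \<oplus> \<one>)" ..
  have "a \<prec> a \<oplus> (c \<oplus> \<one>)" for c
  proof (rule delta0_induct[of "\<lambda>c. a \<prec> a \<oplus> (c \<oplus> \<one>)"])
    show "delta0 M (\<lambda>e. a \<prec> a \<oplus> (e 0 \<oplus> \<one>))" by (intro delta0_rules)
    show "a \<prec> a \<oplus> (\<zero> \<oplus> \<one>)" by (simp add: zero_add less_suc)
    show "a \<prec> a \<oplus> (n \<oplus> \<one>) \<Longrightarrow> a \<prec> a \<oplus> (n \<oplus> \<one> \<oplus> \<one>)" for n
      by (subst add_suc) (simp add: less_suc)
  qed
  then show "\<exists>c. b = a \<oplus> (c \<oplus> \<one>) \<Longrightarrow> a \<prec> b" by blast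
qed

lemma leq_iff_add: "a \<preceq> b \<longleftrightarrow> (\<exists>c. b = a \<oplus> c)"
  unfolding leq_def less_iff_add using zero_or_suc add_zero by metis

lemma add_eq_self: "a \<oplus> c = a \<Longrightarrow> c = \<zero>"
  using add_left_cancel'[of a c \<zero>] by (simp add: add_zero)

lemma add_eq_zero: "a \<oplus> c = \<zero> \<Longrightarrow> c = \<zero>"
  using zero_or_suc[of c] by (auto simp: add_suc suc_neq_zero)

lemma leq_trans: "a \<preceq> b \<Longrightarrow> b \<preceq> c \<Longrightarrow> a \<preceq> c"
  unfolding leq_iff_add by (metis add_assoc)

lemma leq_antisym: "a \<preceq> b \<Longrightarrow> b \<preceq> a \<Longrightarrow> a = b"
  unfolding leq_iff_add by (metis add_assoc add_eq_self add_eq_zero add_zero)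

lemma leq_total: "a \<preceq> b \<or> b \<preceq> a"
proof (rule delta0_induct[of "\<lambda>b. a \<preceq> b \<or> b \<preceq> a"])
  show "delta0 M (\<lambda>e. a \<preceq> e 0 \<or> e 0 \<preceq> a)" by (intro delta0_rules)
  show "a \<preceq> \<zero> \<or> \<zero> \<preceq> a" by (metis leq_iff_add zero_add)
  fix b assume "a \<preceq> b \<or> b \<preceq> a"
  then consider "a \<preceq> b" | "b \<prec> a" unfolding leq_def by blast
  then show "a \<preceq> b \<oplus> \<one> \<or> b \<oplus> \<one> \<preceq> a"
  proof cases
    case 1
    then show ?thesis unfolding leq_def less_suc by blast
  next
    case 2
    then obtain c where "a = b \<oplus> (c \<oplus> \<one>)" using less_iff_add by blast
    then have "a = (b \<oplus> \<one>) \<oplus> c" by (metis add_assoc add_commute)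
    then show ?thesis unfolding leq_iff_add by blast
  qed
qed

lemma not_less_self: "\<not> a \<prec> a"
  unfolding less_iff_add using add_eq_self suc_neq_zero by metis

text \<open>Truncated subtraction, the minus operation that \<open>linordered_semidom\<close> asks
  for. Cancellation makes \<open>THE\<close> well defined, and the default zero makes the law
  \<open>monus (monus a b) c = monus a (b \<oplus> c)\<close> hold throughout.\<close>

definition monus :: "'a \<Rightarrow> 'a \<Rightarrow> 'a" where
  "monus a b = (if b \<preceq> a then THE c. a = b \<oplus> c else \<zero>)"

lemma monus_add: "monus (b \<oplus> c) b = c"
  unfolding monus_def by (auto simp: leq_iff_add dest: add_left_cancel'[rule_format] intro!: the_equality)

lemma monus_zero: "\<not> b \<preceq> a \<Longrightarrow> monus a b = \<zero>"
  by (simp add: monus_def)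

lemma less_le: "a \<prec> b \<longleftrightarrow> a \<preceq> b \<and> a \<noteq> b"
  using leq_def not_less_self by metis

sublocale N: linordered_semidom "(\<oplus>)" monus "(\<preceq>)" "(\<prec>)" \<zero> "(\<otimes>)" \<one>
proof unfold_locales
  have neq: "\<zero> \<noteq> \<one>" using suc_neq_zero[of \<zero>] zero_add by metis
  have zero: "\<zero> \<preceq> a" for a by (auto simp: leq_iff_add zero_add)
  show "a \<oplus> b \<oplus> c = a \<oplus> (b \<oplus> c)" "a \<otimes> b \<otimes> c = a \<otimes> (b \<otimes> c)" "a \<oplus> b = b \<oplus> a" "a \<otimes> b = b \<otimes> a"
    "\<zero> \<oplus> a = a" "\<zero> \<otimes> a = \<zero>" "a \<otimes> \<zero> = \<zero>" "\<one> \<otimes> a = a"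
    "(a \<oplus> b) \<otimes> c = a \<otimes> c \<oplus> b \<otimes> c" "a \<otimes> (b \<oplus> c) = a \<otimes> b \<oplus> a \<otimes> c" for a b c
    by (fact add_assoc mult_assoc add_commute mult_commute zero_add zero_mult mult_zero one_mult distrib
      | simp add: mult_commute[of _ c] distrib)+
  show "monus (a \<oplus> b) a = b" for a b by (fact monus_add)
  show "monus (monus a b) c = monus a (b \<oplus> c)" for a b c
  proof (cases "b \<preceq> a")
    case True
    then obtain d where [simp]: "a = b \<oplus> d" unfolding leq_iff_add by blast
    have "b \<oplus> c \<preceq> a \<longleftrightarrow> c \<preceq> d"
      unfolding leq_iff_add by (auto simp: add_assoc dest: add_left_cancel'[rule_format])
    moreover have "monus (b \<oplus> (c \<oplus> f)) (b \<oplus> c) = f" for f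
      using monus_add[of "b \<oplus> c" f] by (simp add: add_assoc)
    moreover have "\<exists>f. d = c \<oplus> f" if "c \<preceq> d" using that by (simp add: leq_iff_add)
    ultimately show ?thesis
      by (cases "c \<preceq> d") (auto simp: monus_add monus_zero)
  next
    case False
    moreover from this have "\<not> b \<oplus> c \<preceq> a" unfolding leq_iff_add by (metis add_assoc)
    moreover have "monus \<zero> c = \<zero>"
      by (metis add_eq_zero add_zero leq_iff_add monus_add monus_zero)
    ultimately show ?thesis by (simp add: monus_zero)
  qed
  have self: "monus a a = \<zero>" for a using monus_add[of a \<zero>] by (simp add: add_zero)
  have mono: "b \<preceq> c \<Longrightarrow> a \<otimes> b \<preceq> a \<otimes> c" for a b c
    unfolding leq_iff_add by (auto simp: distrib)
  show "a \<otimes> (monus b c) = monus (a \<otimes> b) (a \<otimes> c)" for a b c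
  proof (cases "c \<preceq> b")
    case True
    then show ?thesis by (auto simp: leq_iff_add monus_add distrib)
  next
    case False
    then have "b \<preceq> c" using leq_total by blast
    then have "a \<otimes> b \<preceq> a \<otimes> c" by (rule mono)
    then show ?thesis using False
      by (cases "a \<otimes> c \<preceq> a \<otimes> b") (auto simp: monus_zero mult_zero self dest!: leq_antisym)
  qed
  show "a \<otimes> b \<noteq> \<zero>" if "a \<noteq> \<zero>" "b \<noteq> \<zero>" for a b
    using zero_or_suc[of a] zero_or_suc[of b] that by (auto simp: mult_suc add_suc suc_neq_zero)
  show "c \<otimes> a \<prec> c \<otimes> b" if "a \<prec> b" "\<zero> \<prec> c" for a b c
  proof -
    from that obtain d k where "b = a \<oplus> (d \<oplus> \<one>)" "c = k \<oplus> \<one>"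
      unfolding less_iff_add by (metis zero_add)
    then have "c \<otimes> b = c \<otimes> a \<oplus> ((c \<otimes> d \<oplus> k) \<oplus> \<one>)" by (simp add: distrib add_assoc mult_one)
    then show ?thesis unfolding less_iff_add by blast
  qed
  show "a \<preceq> a" for a by (simp add: leq_def)
  show "a \<preceq> b \<Longrightarrow> b \<preceq> c \<Longrightarrow> a \<preceq> c" for a b c by (rule leq_trans)
  show "a \<preceq> b \<Longrightarrow> b \<preceq> a \<Longrightarrow> a = b" for a b by (rule leq_antisym)
  show "a \<preceq> b \<Longrightarrow> c \<oplus> a \<preceq> c \<oplus> b" for a b c by (auto simp: leq_iff_add add_assoc)
  show "\<zero> \<noteq> \<one>" by (rule neq)
  show "\<zero> \<prec> \<one>" using neq zero by (simp add: less_le)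
  show "b \<preceq> a \<Longrightarrow> monus a b \<oplus> b = a" for a b by (auto simp: leq_iff_add monus_add intro: add_commute)
qed (auto simp: less_le leq_total dest: leq_antisym)

lemma zero_leq [simp]: "\<zero> \<preceq> a"
  by (auto simp: leq_iff_add zero_add)

lemma less_suc_iff [simp]: "a \<prec> b \<oplus> \<one> \<longleftrightarrow> a \<preceq> b"
  by (simp add: less_suc leq_def)

lemma suc_leq_iff: "a \<oplus> \<one> \<preceq> b \<longleftrightarrow> a \<prec> b"
  by (metis N.not_le less_suc_iff)

lemma leq_add [simp]: "a \<preceq> a \<oplus> b" "a \<preceq> b \<oplus> a"
  by (auto simp: leq_iff_add add_commute)

lemma leq_mult: "d \<noteq> \<zero> \<Longrightarrow> q \<preceq> d \<otimes> q"
  using zero_or_suc[of d] by (auto simp: suc_mult)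

section \<open>Minimisation, closure of Sigma_1 and collection\<close>

lemma delta0_bex_leq:
  "term_fun M t \<Longrightarrow> delta0 M (\<lambda>e. Q (\<lambda>i. e (Suc i)) (e 0)) \<Longrightarrow>
    delta0 M (\<lambda>e. \<exists>x. x \<preceq> t e \<and> Q e x)"
  using delta0.bex[of M "\<lambda>e. t e \<oplus> \<one>" Q] term_fun.plus[OF _ term_fun.const, of M t \<one>] by simp

lemma delta0_ball_leq:
  "term_fun M t \<Longrightarrow> delta0 M (\<lambda>e. Q (\<lambda>i. e (Suc i)) (e 0)) \<Longrightarrow>
    delta0 M (\<lambda>e. \<forall>x. x \<preceq> t e \<longrightarrow> Q e x)"
  using delta0_ball[of M "\<lambda>e. t e \<oplus> \<one>" Q] term_fun.plus[OF _ term_fun.const, of M t \<one>] by simp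

text \<open>The induction runs over a bound for the witness, so that its statement stays
  bounded.\<close>

lemma least_number:
  assumes "delta0 M (\<lambda>e. P (e 0))" "P n"
  obtains m where "P m" "\<And>k. k \<prec> m \<Longrightarrow> \<not> P k" "m \<preceq> n"
proof -
  note P = delta0_subst1[OF assms(1)]
  have "(\<exists>k. k \<preceq> n \<and> P k) \<longrightarrow> (\<exists>m. m \<preceq> n \<and> (P m \<and> (\<forall>k. k \<prec> m \<longrightarrow> \<not> P k)))"
  proof (rule delta0_induct[of "\<lambda>n. (\<exists>k. k \<preceq> n \<and> P k) \<longrightarrow> (\<exists>m. m \<preceq> n \<and> (P m \<and> (\<forall>k. k \<prec> m \<longrightarrow> \<not> P k)))"])
    show "delta0 M (\<lambda>e. (\<exists>k. k \<preceq> e 0 \<and> P k) \<longrightarrow> (\<exists>m. m \<preceq> e 0 \<and> (P m \<and> (\<forall>k. k \<prec> m \<longrightarrow> \<not> P k))))"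
      by (intro delta0_bex_leq delta0_rules P)
    show "(\<exists>k. k \<preceq> \<zero> \<and> P k) \<longrightarrow> (\<exists>m. m \<preceq> \<zero> \<and> (P m \<and> (\<forall>k. k \<prec> m \<longrightarrow> \<not> P k)))"
      by (metis leq_def not_less_zero)
    fix n assume IH: "(\<exists>k. k \<preceq> n \<and> P k) \<longrightarrow> (\<exists>m. m \<preceq> n \<and> (P m \<and> (\<forall>k. k \<prec> m \<longrightarrow> \<not> P k)))"
    show "(\<exists>k. k \<preceq> n \<oplus> \<one> \<and> P k) \<longrightarrow> (\<exists>m. m \<preceq> n \<oplus> \<one> \<and> (P m \<and> (\<forall>k. k \<prec> m \<longrightarrow> \<not> P k)))"
    proof (cases "\<exists>k. k \<preceq> n \<and> P k")
      case True
      with IH show ?thesis by (metis leq_trans leq_add(1))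
    next
      case False
      then show ?thesis by (metis leq_def less_suc_iff)
    qed
  qed
  then show ?thesis using assms(2) that by blast
qed

lemma delta0_compose: "delta0 M R \<Longrightarrow> (\<And>i. term_fun M (\<lambda>e. \<tau> e i)) \<Longrightarrow> delta0 M (\<lambda>e. R (\<tau> e))"
  by (rule delta0_subst[of M R "\<lambda>i e. \<tau> e i"])

lemma term_fun_case_nat:
  "term_fun M s \<Longrightarrow> (\<And>i. term_fun M (\<lambda>e. t e i)) \<Longrightarrow> term_fun M (\<lambda>e. case_nat (s e) (t e) i)"
  by (cases i) auto

text \<open>Two unbounded quantifiers contract to one over a common bound of both witnesses, for
  instance their sum.\<close>

lemma sigma1_ex:
  assumes "sigma1 M (\<lambda>e. Q (\<lambda>i. e (Suc i)) (e 0))"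
  shows "sigma1 M (\<lambda>e. \<exists>x. Q e x)"
proof -
  obtain R where R: "delta0 M R" "\<And>e. Q (\<lambda>i. e (Suc i)) (e 0) \<longleftrightarrow> (\<exists>y. R (case_nat y e))"
    using assms unfolding sigma1_def by blast
  have Q: "Q e x \<longleftrightarrow> (\<exists>y. R (case_nat y (case_nat x e)))" for e x
    using R(2)[of "case_nat x e"] by simp
  have "sigma1 M (\<lambda>e. \<exists>z. \<exists>x. x \<preceq> z \<and> (\<exists>y. y \<preceq> z \<and> R (case_nat y (case_nat x e))))"
    by (intro sigma1_ex_delta0 delta0_bex_leq delta0_compose[OF R(1)] term_fun_case_nat term_fun.var)
  also have "(\<lambda>e. \<exists>z. \<exists>x. x \<preceq> z \<and> (\<exists>y. y \<preceq> z \<and> R (case_nat y (case_nat x e)))) = (\<lambda>e. \<exists>x. Q e x)"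
    unfolding Q by (meson leq_add)
  finally show ?thesis .
qed

lemma sigma1_conj:
  assumes "sigma1 M P" "sigma1 M Q"
  shows "sigma1 M (\<lambda>e. P e \<and> Q e)"
proof -
  obtain R S where R: "delta0 M R" "\<And>e. P e \<longleftrightarrow> (\<exists>y. R (case_nat y e))"
    and S: "delta0 M S" "\<And>e. Q e \<longleftrightarrow> (\<exists>y. S (case_nat y e))"
    using assms unfolding sigma1_def by blast
  have "sigma1 M (\<lambda>e. \<exists>x y. R (case_nat x e) \<and> S (case_nat y e))"
    by (intro sigma1_ex sigma1_ex_delta0 delta0.conj delta0_compose[OF R(1)] delta0_compose[OF S(1)]
        term_fun_case_nat term_fun.var)
  then show ?thesis by (simp add: R(2) S(2))
qed

lemma sigma1_disj:
  assumes "sigma1 M P" "sigma1 M Q"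
  shows "sigma1 M (\<lambda>e. P e \<or> Q e)"
proof -
  obtain R S where R: "delta0 M R" "\<And>e. P e \<longleftrightarrow> (\<exists>y. R (case_nat y e))"
    and S: "delta0 M S" "\<And>e. Q e \<longleftrightarrow> (\<exists>y. S (case_nat y e))"
    using assms unfolding sigma1_def by blast
  have "sigma1 M (\<lambda>e. \<exists>x. R (case_nat x e) \<or> S (case_nat x e))"
    by (intro sigma1_ex_delta0 delta0_disj delta0_compose[OF R(1)] delta0_compose[OF S(1)]
        term_fun_case_nat term_fun.var)
  then show ?thesis by (simp add: R(2) S(2) ex_disj_distrib)
qed

text \<open>Bounding for bounded matrices follows from Sigma_1 induction: a bound for the arguments
  up to k is enlarged by a witness for the next one. The premise \<open>k \<preceq> w\<close>
  restricts the induction to arguments that have a witness.\<close>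

lemma collection:
  assumes "delta0 M (\<lambda>e. P (e 0) (e 1))" "\<And>y. y \<preceq> w \<Longrightarrow> \<exists>v. P y v"
  shows "\<exists>s. \<forall>y. y \<preceq> w \<longrightarrow> (\<exists>v. v \<preceq> s \<and> P y v)"
proof -
  note P = delta0_subst2[OF assms(1)]
  have "w \<preceq> w \<longrightarrow> (\<exists>s. \<forall>y. y \<preceq> w \<longrightarrow> (\<exists>v. v \<preceq> s \<and> P y v))"
  proof (rule sigma1_induct[of "\<lambda>k. k \<preceq> w \<longrightarrow> (\<exists>s. \<forall>y. y \<preceq> k \<longrightarrow> (\<exists>v. v \<preceq> s \<and> P y v))"])
    have "sigma1 M (\<lambda>e. \<exists>s. e 0 \<preceq> w \<longrightarrow> (\<forall>y. y \<preceq> e 0 \<longrightarrow> (\<exists>v. v \<preceq> s \<and> P y v)))"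
      by (intro sigma1_ex_delta0 delta0_bex_leq delta0_ball_leq delta0_rules P)
    then show "sigma1 M (\<lambda>e. e 0 \<preceq> w \<longrightarrow> (\<exists>s. \<forall>y. y \<preceq> e 0 \<longrightarrow> (\<exists>v. v \<preceq> s \<and> P y v)))" by simp
    obtain v where "P \<zero> v" using assms(2)[of \<zero>] by auto
    then show "\<zero> \<preceq> w \<longrightarrow> (\<exists>s. \<forall>y. y \<preceq> \<zero> \<longrightarrow> (\<exists>v. v \<preceq> s \<and> P y v))"
      by (metis N.order.refl leq_def not_less_zero)
    fix k assume IH: "k \<preceq> w \<longrightarrow> (\<exists>s. \<forall>y. y \<preceq> k \<longrightarrow> (\<exists>v. v \<preceq> s \<and> P y v))"
    show "k \<oplus> \<one> \<preceq> w \<longrightarrow> (\<exists>s. \<forall>y. y \<preceq> k \<oplus> \<one> \<longrightarrow> (\<exists>v. v \<preceq> s \<and> P y v))"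
    proof
      assume le: "k \<oplus> \<one> \<preceq> w"
      then have "k \<preceq> w" using leq_add(1) leq_trans by blast
      with IH obtain s where s: "\<And>y. y \<preceq> k \<Longrightarrow> \<exists>v. v \<preceq> s \<and> P y v" by blast
      from assms(2)[OF le] obtain v where v: "P (k \<oplus> \<one>) v" by blast
      have "\<exists>v'. v' \<preceq> s \<oplus> v \<and> P y v'" if "y \<preceq> k \<oplus> \<one>" for y
        using that s[of y] v leq_trans leq_add by (metis leq_def less_suc_iff)
      then show "\<exists>s. \<forall>y. y \<preceq> k \<oplus> \<one> \<longrightarrow> (\<exists>v. v \<preceq> s \<and> P y v)" by blast
    qed
  qed
  then show ?thesis by (simp add: leq_def)
qed

text \<open>\<open>least_number\<close> does not apply to the upper bounds, which form a Pi_1 class.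
  But in a class without largest element, Sigma_1 induction on k finds elements above every k,
  against the bound.\<close>

lemma sigma1_maximum:
  assumes "sigma1 M (\<lambda>e. P (e 0))" "P c" "\<And>c. P c \<Longrightarrow> c \<preceq> b"
  obtains m where "P m" "\<And>c. P c \<Longrightarrow> c \<preceq> m"
proof (rule ccontr)
  assume "\<not> thesis"
  then have step: "\<exists>c'. c \<prec> c' \<and> P c'" if "P c" for c
    using that \<open>\<And>m. P m \<Longrightarrow> (\<And>c. P c \<Longrightarrow> c \<preceq> m) \<Longrightarrow> thesis\<close> by (meson N.not_le)
  have "\<exists>c. k \<preceq> c \<and> P c" for k
  proof (rule sigma1_induct[of "\<lambda>k. \<exists>c. k \<preceq> c \<and> P c"])
    show "sigma1 M (\<lambda>e. \<exists>c. e 0 \<preceq> c \<and> P c)"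
      by (intro sigma1_ex sigma1_conj sigma1_subst1[OF assms(1)] sigma1_delta0 delta0_rules)
    show "\<exists>c. \<zero> \<preceq> c \<and> P c" using assms(2) by auto
    show "\<exists>c. n \<oplus> \<one> \<preceq> c \<and> P c" if "\<exists>c. n \<preceq> c \<and> P c" for n
    proof -
      from that obtain c where c: "n \<preceq> c" "P c" by blast
      with step obtain c' where "c \<prec> c'" "P c'" by blast
      with c show ?thesis unfolding suc_leq_iff by (metis N.order.strict_trans1)
    qed
  qed
  then obtain c where "b \<oplus> \<one> \<preceq> c" "P c" by blast
  with assms(3)[of c] show False by (simp add: suc_leq_iff N.not_le[symmetric])
qed

section \<open>Pairs and functions\<close>

lemma leq_pair: "a \<preceq> \<langle>a, b\<rangle>" "b \<preceq> \<langle>a, b\<rangle>"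
proof -
  show "a \<preceq> \<langle>a, b\<rangle>" by (simp add: pair_def)
  have "b \<preceq> (a \<oplus> b) \<otimes> (a \<oplus> b)"
  proof (cases "a \<oplus> b = \<zero>")
    case True
    then show ?thesis by (metis leq_add(2) zero_mult)
  next
    case False
    then show ?thesis by (metis leq_add(2) leq_mult leq_trans)
  qed
  then show "b \<preceq> \<langle>a, b\<rangle>" unfolding pair_def by (metis leq_add(1) leq_trans)
qed

text \<open>With s the sum of the components, the code lies between the squares of s and s + 1,
  strictly below the latter. So it determines s, then the first component, then the second.\<close>

lemma pair_inject [simp]: "\<langle>a, b\<rangle> = \<langle>a', b'\<rangle> \<longleftrightarrow> a = a' \<and> b = b'"
proof
  have less: "\<langle>a, b\<rangle> \<prec> \<langle>a', b'\<rangle>" if lt: "a \<oplus> b \<prec> a' \<oplus> b'" for a b a' b'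
  proof -
    let ?s = "a \<oplus> b" and ?t = "a' \<oplus> b'"
    have "\<langle>a, b\<rangle> \<preceq> ?s \<otimes> ?s \<oplus> ?s" by (simp add: pair_def)
    also have "\<dots> \<preceq> (?s \<oplus> \<one>) \<otimes> ?s"
      by (simp add: suc_mult)
    also have "\<dots> \<prec> (?s \<oplus> \<one>) \<otimes> (?s \<oplus> \<one>)"
      by (simp only: mult_suc[of "?s \<oplus> \<one>"] add_suc less_suc_iff leq_add)
    also have "\<dots> \<preceq> ?t \<otimes> ?t" using lt unfolding suc_leq_iff[symmetric] by (intro N.mult_mono') auto
    also have "\<dots> \<preceq> \<langle>a', b'\<rangle>" by (simp add: pair_def)
    finally show ?thesis .
  qed
  assume eq: "\<langle>a, b\<rangle> = \<langle>a', b'\<rangle>"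
  then have s: "a \<oplus> b = a' \<oplus> b'"
    using less[of a b a' b'] less[of a' b' a b] by (metis N.less_irrefl N.neq_iff)
  with eq have "a = a'" unfolding pair_def using add_left_cancel' by metis
  with s show "a = a' \<and> b = b'" using add_left_cancel' by metis
qed simp

text \<open>Components are at most the code of their pair, so unpacking a pair is a bounded
  search.\<close>

lemma delta0_bex_pair:
  assumes "term_fun M t" "delta0 M (\<lambda>e. Q (\<lambda>i. e (Suc (Suc i))) (e 1) (e 0))"
  shows "delta0 M (\<lambda>e. \<exists>a b. t e = \<langle>a, b\<rangle> \<and> Q e a b)"
proof -
  note t = term_fun_shift[OF assms(1)] term_fun_shift[OF term_fun_shift[OF assms(1)]]
  have "delta0 M (\<lambda>e. \<exists>a. a \<preceq> t e \<and> (\<exists>b. b \<preceq> t e \<and> (t e = \<langle>a, b\<rangle> \<and> Q e a b)))"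
    using assms(2) by (intro delta0_bex_leq delta0_rules assms(1) t) simp
  also have "(\<lambda>e. \<exists>a. a \<preceq> t e \<and> (\<exists>b. b \<preceq> t e \<and> (t e = \<langle>a, b\<rangle> \<and> Q e a b))) =
      (\<lambda>e. \<exists>a b. t e = \<langle>a, b\<rangle> \<and> Q e a b)"
    by (intro ext) (metis leq_pair)
  finally show ?thesis .
qed

lemma relation_exists:
  assumes "delta0 M (\<lambda>e. R (e 0) (e 1))"
  shows "{p. \<exists>a b. p = \<langle>a, b\<rangle> \<and> R a b} \<in> sets M"
  by (intro delta0_comprehension delta0_bex_pair delta0_rules delta0_subst2[OF assms])

definition fun_set :: "'a set \<Rightarrow> bool" where
  "fun_set F \<longleftrightarrow> F \<in> sets M \<and> (\<forall>p. p \<in> F \<longrightarrow> (\<exists>i j. p = \<langle>i, j\<rangle>)) \<and> (\<forall>i. \<exists>j. \<langle>i, j\<rangle> \<in> F) \<and>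
    (\<forall>i j k. \<langle>i, j\<rangle> \<in> F \<and> \<langle>i, k\<rangle> \<in> F \<longrightarrow> j = k)"

text \<open>A total single-valued Sigma_1 graph is Delta_1: a pair lies outside iff some other value
  belongs to its first component.\<close>

lemma function_exists:
  assumes G: "sigma1 M (\<lambda>e. G (e 0) (e 1))" and ex1: "\<And>i. \<exists>!j. G i j"
  obtains F where "fun_set F" "\<And>i j. \<langle>i, j\<rangle> \<in> F \<longleftrightarrow> G i j"
proof -
  define F where "F = {p. \<exists>i j. p = \<langle>i, j\<rangle> \<and> G i j}"
  \<comment> \<open>The trivial conjunct provides the body that \<open>delta0_bex_pair\<close>
    expects and is simplified away at once.\<close>
  have "delta0 M (\<lambda>e. \<exists>i j. e 0 = \<langle>i, j\<rangle> \<and> i = i)" by (intro delta0_bex_pair delta0_rules)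
  then have code: "delta0 M (\<lambda>e. \<exists>i j. e 0 = \<langle>i, j\<rangle>)" by simp
  have "F \<in> sets M" unfolding F_def
  proof (rule delta1_comprehension)
    show "sigma1 M (\<lambda>e. \<exists>i j. e 0 = \<langle>i, j\<rangle> \<and> G i j)"
      by (intro sigma1_ex sigma1_conj sigma1_subst2[OF G] sigma1_delta0 delta0_rules)
    have "sigma1 M (\<lambda>e. \<not> (\<exists>i j. e 0 = \<langle>i, j\<rangle>) \<or> (\<exists>i j k. (e 0 = \<langle>i, j\<rangle> \<and> j \<noteq> k) \<and> G i k))"
      by (intro sigma1_disj sigma1_ex sigma1_conj sigma1_subst2[OF G] sigma1_delta0 delta0.neg[OF code] delta0_rules)
    also have "(\<lambda>e. \<not> (\<exists>i j. e 0 = \<langle>i, j\<rangle>) \<or> (\<exists>i j k. (e 0 = \<langle>i, j\<rangle> \<and> j \<noteq> k) \<and> G i k)) =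
      (\<lambda>e. \<not> (\<exists>i j. e 0 = \<langle>i, j\<rangle> \<and> G i j))"
    proof
      fix e :: "nat \<Rightarrow> 'a"
      show "(\<not> (\<exists>i j. e 0 = \<langle>i, j\<rangle>) \<or> (\<exists>i j k. (e 0 = \<langle>i, j\<rangle> \<and> j \<noteq> k) \<and> G i k)) =
        (\<not> (\<exists>i j. e 0 = \<langle>i, j\<rangle> \<and> G i j))"
      proof (cases "\<exists>i j. e 0 = \<langle>i, j\<rangle>")
        case True
        then obtain i j where "e 0 = \<langle>i, j\<rangle>" by blast
        then show ?thesis using ex1[of i] by auto
      qed auto
    qed
    finally show "sigma1 M (\<lambda>e. \<not> (\<exists>i j. e 0 = \<langle>i, j\<rangle> \<and> G i j))" .
  qed
  moreover have *: "\<langle>i, j\<rangle> \<in> F \<longleftrightarrow> G i j" for i j by (auto simp: F_def)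
  moreover have "fun_set F"
    using calculation(1) ex1 unfolding fun_set_def * by (auto simp: F_def) metis+
  ultimately show ?thesis using that by blast
qed


section \<open>Coded finite sets and iteration\<close>

text \<open>For suitable \<open>m\<close> the moduli are pairwise coprime, so divisibility of
  \<open>n\<close> by each of them can be prescribed independently. The bound on \<open>q\<close>
  keeps the predicate bounded and loses nothing, the modulus being nonzero.\<close>

definition code_elem :: "'a \<Rightarrow> 'a \<Rightarrow> 'a \<Rightarrow> 'a \<Rightarrow> bool" where
  "code_elem k m n i \<longleftrightarrow> i \<prec> k \<and> (\<exists>q. q \<preceq> n \<and> n = (m \<otimes> (i \<oplus> \<one>) \<oplus> \<one>) \<otimes> q)"

lemma delta0_code_elem:
  assumes "term_fun M k" "term_fun M m" "term_fun M n" "term_fun M i"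
  shows "delta0 M (\<lambda>e. code_elem (k e) (m e) (n e) (i e))"
  unfolding code_elem_def
  by (intro delta0_bex_leq delta0_rules assms assms[THEN term_fun_shift])

lemma code_elem_iff_dvd: "code_elem k m n i \<longleftrightarrow> i \<prec> k \<and> N.dvd (m \<otimes> (i \<oplus> \<one>) \<oplus> \<one>) n"
  unfolding code_elem_def N.dvd_def using leq_mult[OF suc_neq_zero] by blast

text \<open>Stands in for the factorial, whose definition would itself require recursion.\<close>

lemma common_multiple: "\<exists>m. m \<noteq> \<zero> \<and> (\<forall>d. d \<prec> k \<longrightarrow> d \<noteq> \<zero> \<longrightarrow> N.dvd d m)"
proof -
  have "\<exists>m. m \<noteq> \<zero> \<and> (\<forall>d. d \<prec> k \<longrightarrow> d \<noteq> \<zero> \<longrightarrow> (\<exists>q. q \<preceq> m \<and> m = d \<otimes> q))"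
  proof (rule sigma1_induct[of "\<lambda>k. \<exists>m. m \<noteq> \<zero> \<and> (\<forall>d. d \<prec> k \<longrightarrow> d \<noteq> \<zero> \<longrightarrow> (\<exists>q. q \<preceq> m \<and> m = d \<otimes> q))"])
    show "sigma1 M (\<lambda>e. \<exists>m. m \<noteq> \<zero> \<and> (\<forall>d. d \<prec> e 0 \<longrightarrow> d \<noteq> \<zero> \<longrightarrow> (\<exists>q. q \<preceq> m \<and> m = d \<otimes> q)))"
      by (intro sigma1_ex_delta0 delta0_bex_leq delta0_rules)
    show "\<exists>m. m \<noteq> \<zero> \<and> (\<forall>d. d \<prec> \<zero> \<longrightarrow> d \<noteq> \<zero> \<longrightarrow> (\<exists>q. q \<preceq> m \<and> m = d \<otimes> q))"
      using not_less_zero N.zero_neq_one by metis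
    fix k assume "\<exists>m. m \<noteq> \<zero> \<and> (\<forall>d. d \<prec> k \<longrightarrow> d \<noteq> \<zero> \<longrightarrow> (\<exists>q. q \<preceq> m \<and> m = d \<otimes> q))"
    then obtain m where m: "m \<noteq> \<zero>" "\<And>d. d \<prec> k \<Longrightarrow> d \<noteq> \<zero> \<Longrightarrow> \<exists>q. m = d \<otimes> q" by blast
    show "\<exists>m. m \<noteq> \<zero> \<and> (\<forall>d. d \<prec> k \<oplus> \<one> \<longrightarrow> d \<noteq> \<zero> \<longrightarrow> (\<exists>q. q \<preceq> m \<and> m = d \<otimes> q))"
    \<comment> \<open>Multiplying by the divisor 0 would destroy \<open>m \<noteq> \<zero>\<close>,
      so \<open>m\<close> is kept in this case.\<close>
    proof (cases "k = \<zero>")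
      case True
      then have "d = \<zero>" if "d \<prec> k \<oplus> \<one>" for d
        using that by (simp only: less_suc_iff leq_antisym[OF _ zero_leq])
      then show ?thesis using m(1) by blast
    next
      case False
      have "\<exists>q. q \<preceq> m \<otimes> k \<and> m \<otimes> k = d \<otimes> q" if d: "d \<preceq> k" "d \<noteq> \<zero>" for d
      proof (cases "d = k")
        case True
        then show ?thesis using m(1) by (intro exI[of _ m]) (metis leq_mult mult_commute d(2))
      next
        case False
        with d m(2)[of d] obtain q where "m = d \<otimes> q" by (auto simp: less_le)
        then show ?thesis using d(2)
          by (intro exI[of _ "q \<otimes> k"]) (simp add: mult_assoc leq_mult)
      qed
      then show ?thesis using m(1) False by (intro exI[of _ "m \<otimes> k"]) simp
    qed
  qed
  then show ?thesis unfolding N.dvd_def by blast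
qed

text \<open>Bezout: \<open>(j + 1) (m (i + 1) + 1) - (i + 1) (m (j + 1) + 1) = j - i\<close>, a divisor of \<open>m\<close>.\<close>

lemma dvd_cancel_coprime:
  assumes ij: "i \<noteq> j" and m: "\<And>d. d \<preceq> i \<oplus> j \<Longrightarrow> d \<noteq> \<zero> \<Longrightarrow> N.dvd d m"
    and dvd: "N.dvd (m \<otimes> (i \<oplus> \<one>) \<oplus> \<one>) (n \<otimes> (m \<otimes> (j \<oplus> \<one>) \<oplus> \<one>))"
  shows "N.dvd (m \<otimes> (i \<oplus> \<one>) \<oplus> \<one>) n"
proof -
  let ?a = "m \<otimes> (i \<oplus> \<one>) \<oplus> \<one>" and ?b = "m \<otimes> (j \<oplus> \<one>) \<oplus> \<one>"
  obtain d where d: "d \<noteq> \<zero>" "d \<preceq> i \<oplus> j" "N.dvd ?a (n \<otimes> d)"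
  proof -
    consider d where "d \<noteq> \<zero>" "j = i \<oplus> d" | d where "d \<noteq> \<zero>" "i = j \<oplus> d"
      using leq_total[of i j] ij unfolding leq_iff_add by (metis add_zero)
    then show ?thesis
    proof cases
      case 1
      have "n \<otimes> ?b \<otimes> (i \<oplus> \<one>) \<oplus> n \<otimes> d = ?a \<otimes> (n \<otimes> (j \<oplus> \<one>))"
        unfolding 1(2) by (simp add: algebra_simps)
      moreover have "N.dvd ?a (n \<otimes> ?b \<otimes> (i \<oplus> \<one>))" using dvd by (rule N.dvd_mult2)
      ultimately have "N.dvd ?a (n \<otimes> d)"
        using N.dvd_add_right_iff[of ?a "n \<otimes> ?b \<otimes> (i \<oplus> \<one>)" "n \<otimes> d"] N.dvd_triv_left by metis
      then show ?thesis using that[of d] 1 by (metis leq_add(2) add_assoc)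
    next
      case 2
      have "n \<otimes> ?b \<otimes> (i \<oplus> \<one>) = ?a \<otimes> (n \<otimes> (j \<oplus> \<one>)) \<oplus> n \<otimes> d"
        unfolding 2(2) by (simp add: algebra_simps)
      moreover have "N.dvd ?a (n \<otimes> ?b \<otimes> (i \<oplus> \<one>))" using dvd by (rule N.dvd_mult2)
      ultimately have "N.dvd ?a (n \<otimes> d)"
        using N.dvd_add_right_iff[of ?a "?a \<otimes> (n \<otimes> (j \<oplus> \<one>))" "n \<otimes> d"] N.dvd_triv_left by metis
      then show ?thesis using that[of d] 2 by (metis leq_add(2) add_assoc add_commute)
    qed
  qed
  \<comment> \<open>With a for \<open>?a\<close>: a divides n d and d divides m, so a divides n m (i
    + 1); adding n to this gives the multiple a n, so a divides n.\<close>
  have "N.dvd d m" using m d by blast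
  then obtain q where "m = d \<otimes> q" unfolding N.dvd_def by blast
  then have "n \<otimes> m \<otimes> (i \<oplus> \<one>) = n \<otimes> d \<otimes> (q \<otimes> (i \<oplus> \<one>))" by (simp add: mult_assoc)
  then have "N.dvd ?a (n \<otimes> m \<otimes> (i \<oplus> \<one>))" using d(3) N.dvd_mult2 by metis
  moreover have "n \<otimes> m \<otimes> (i \<oplus> \<one>) \<oplus> n = ?a \<otimes> n" by (simp add: algebra_simps)
  ultimately show ?thesis using N.dvd_add_right_iff N.dvd_triv_left by metis
qed

text \<open>Sigma_1 induction on a threshold j: to admit j, the code is multiplied by the modulus of
  j, which by coprimality affects the membership of j only.\<close>

lemma finite_set_code:
  assumes P: "delta0 M (\<lambda>e. P (e 0))"
  obtains m n where "\<And>i. code_elem k m n i \<longleftrightarrow> i \<prec> k \<and> P i"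
proof -
  \<comment> \<open>For i, j below k, \<open>dvd_cancel_coprime\<close> needs the divisors up to i +
    j, which are below k + k.\<close>
  obtain m where m: "m \<noteq> \<zero>" "\<And>d. d \<prec> k \<oplus> k \<Longrightarrow> d \<noteq> \<zero> \<Longrightarrow> N.dvd d m"
    using common_multiple[of "k \<oplus> k"] by blast
  have "\<exists>n. \<forall>i. i \<prec> k \<longrightarrow> (code_elem k m n i \<longleftrightarrow> i \<prec> k \<and> P i)"
  proof (rule sigma1_induct[of "\<lambda>j. \<exists>n. \<forall>i. i \<prec> k \<longrightarrow> (code_elem k m n i \<longleftrightarrow> i \<prec> j \<and> P i)"])
    show "sigma1 M (\<lambda>e. \<exists>n. \<forall>i. i \<prec> k \<longrightarrow> (code_elem k m n i \<longleftrightarrow> i \<prec> e 0 \<and> P i))"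
      by (intro sigma1_ex_delta0 delta0_code_elem delta0_subst1[OF P] delta0_rules)
    \<comment> \<open>As m is nonzero, all moduli exceed 1, and the code 1 represents the empty
      set.\<close>
    have "\<not> N.dvd (m \<otimes> (i \<oplus> \<one>) \<oplus> \<one>) \<one>" for i
    proof
      assume "N.dvd (m \<otimes> (i \<oplus> \<one>) \<oplus> \<one>) \<one>"
      then obtain q where q: "\<one> = (m \<otimes> (i \<oplus> \<one>) \<oplus> \<one>) \<otimes> q" unfolding N.dvd_def by blast
      then have "q \<noteq> \<zero>" using N.zero_neq_one by (metis mult_zero)
      then have "m \<otimes> (i \<oplus> \<one>) \<oplus> \<one> \<preceq> \<one>" using leq_mult[of q] q by (metis mult_commute)
      then have "m \<otimes> (i \<oplus> \<one>) \<prec> \<one>" by (simp only: suc_leq_iff)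
      then have "m \<otimes> (i \<oplus> \<one>) = \<zero>" by (metis less_suc_iff zero_add leq_antisym zero_leq)
      then show False using m(1) suc_neq_zero N.mult_eq_0_iff by blast
    qed
    then show "\<exists>n. \<forall>i. i \<prec> k \<longrightarrow> (code_elem k m n i \<longleftrightarrow> i \<prec> \<zero> \<and> P i)"
      by (intro exI[of _ \<one>]) (simp add: code_elem_iff_dvd not_less_zero)
    fix j assume "\<exists>n. \<forall>i. i \<prec> k \<longrightarrow> (code_elem k m n i \<longleftrightarrow> i \<prec> j \<and> P i)"
    then obtain n where n: "\<And>i. i \<prec> k \<Longrightarrow> code_elem k m n i \<longleftrightarrow> i \<prec> j \<and> P i" by blast
    show "\<exists>n. \<forall>i. i \<prec> k \<longrightarrow> (code_elem k m n i \<longleftrightarrow> i \<prec> j \<oplus> \<one> \<and> P i)"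
    proof (cases "j \<prec> k \<and> P j")
      case False
      then have "i \<prec> j \<oplus> \<one> \<and> P i \<longleftrightarrow> i \<prec> j \<and> P i" if "i \<prec> k" for i
        using that by (auto simp: leq_def)
      with n show ?thesis by blast
    next
      case True
      let ?n = "n \<otimes> (m \<otimes> (j \<oplus> \<one>) \<oplus> \<one>)"
      have "code_elem k m ?n i \<longleftrightarrow> i \<prec> j \<oplus> \<one> \<and> P i" if i: "i \<prec> k" for i
      proof (cases "i = j")
        case i: True
        then show ?thesis using True by (simp add: code_elem_iff_dvd leq_def)
      next
        case ne: False
        have "i \<oplus> j \<prec> k \<oplus> k" using i True by (simp add: N.add_strict_mono)
        then have "d \<preceq> i \<oplus> j \<Longrightarrow> d \<noteq> \<zero> \<Longrightarrow> N.dvd d m" for d by (intro m(2)) order+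
        from dvd_cancel_coprime[OF ne this] have
          "N.dvd (m \<otimes> (i \<oplus> \<one>) \<oplus> \<one>) ?n \<Longrightarrow> N.dvd (m \<otimes> (i \<oplus> \<one>) \<oplus> \<one>) n" by blast
        then have "code_elem k m ?n i \<longleftrightarrow> code_elem k m n i"
          unfolding code_elem_iff_dvd using N.dvd_mult2 by blast
        then show ?thesis using n[OF i] ne by (simp add: leq_def)
      qed
      then show ?thesis by blast
    qed
  qed
  then show ?thesis using that unfolding code_elem_def by metis
qed

text \<open>A finite computation as a set of pairs, each of them initial or justified by another. It
  may a priori hold several values per index; uniqueness is proved in \<open>iteration\<close>. All
  quantifiers are bounded by \<open>k\<close>, which by \<open>code_elem_pair_less\<close> excludes
  no component of a member.\<close>

definition derivation :: "'a \<Rightarrow> ('a \<Rightarrow> 'a \<Rightarrow> bool) \<Rightarrow> 'a \<Rightarrow> 'a \<Rightarrow> 'a \<Rightarrow> bool" where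
  "derivation a R k m n \<longleftrightarrow> (\<forall>i. i \<prec> k \<longrightarrow> (\<forall>x. x \<prec> k \<longrightarrow> code_elem k m n \<langle>i, x\<rangle> \<longrightarrow>
    i = \<zero> \<and> x = a \<or> (\<exists>j. j \<prec> k \<and> (\<exists>y. y \<prec> k \<and> (i = j \<oplus> \<one> \<and> code_elem k m n \<langle>j, y\<rangle> \<and> R y x)))))"

lemma code_elem_pair_less:
  assumes "code_elem k m n \<langle>i, x\<rangle>"
  shows "i \<prec> k" "x \<prec> k"
  using assms N.order.strict_trans1[OF leq_pair(1)[of i x]] N.order.strict_trans1[OF leq_pair(2)[of x i]]
  by (auto simp: code_elem_def)

lemma derivationD:
  assumes "derivation a R k m n" "code_elem k m n \<langle>i, x\<rangle>"
  shows "i = \<zero> \<and> x = a \<or> (\<exists>j y. i = j \<oplus> \<one> \<and> code_elem k m n \<langle>j, y\<rangle> \<and> R y x)"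
proof -
  show ?thesis using assms code_elem_pair_less[OF assms(2)] unfolding derivation_def by blast
qed

lemma derivationI:
  assumes "\<And>i x. code_elem k m n \<langle>i, x\<rangle> \<Longrightarrow> i = \<zero> \<and> x = a \<or> (\<exists>j y. i = j \<oplus> \<one> \<and> code_elem k m n \<langle>j, y\<rangle> \<and> R y x)"
  shows "derivation a R k m n"
proof -
  show ?thesis using assms code_elem_pair_less unfolding derivation_def by blast
qed

text \<open>The graph "some derivation contains the pair" is Sigma_1. Existence of values needs
  Sigma_1 induction, as derivations grow without a given bound; then \<open>function_exists\<close>
  applies.\<close>

lemma iteration:
  assumes R: "delta0 M (\<lambda>e. R (e 0) (e 1))" and ex1: "\<And>x. \<exists>!y. R x y"
  obtains H where "fun_set H" "\<And>i x y. \<langle>i, x\<rangle> \<in> H \<Longrightarrow> \<langle>i \<oplus> \<one>, y\<rangle> \<in> H \<Longrightarrow> R x y"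
    "\<And>x. \<langle>\<zero>, x\<rangle> \<in> H \<Longrightarrow> x = a"
proof -
  define G where "G i x \<longleftrightarrow> (\<exists>k m n. derivation a R k m n \<and> code_elem k m n \<langle>i, x\<rangle>)" for i x
  note rules = delta0_code_elem delta0_subst2[OF R] delta0_bex_leq delta0_rules
  have G: "sigma1 M (\<lambda>e. G (e 0) (e 1))"
    unfolding G_def derivation_def
    by (intro sigma1_ex sigma1_delta0 rules)
  have unique: "x = x'" if "G i x" "G i x'" for i x x'
  proof -
    from that obtain k m n k' m' n' where
      d: "derivation a R k m n" "derivation a R k' m' n'"
      and el: "code_elem k m n \<langle>i, x\<rangle>" "code_elem k' m' n' \<langle>i, x'\<rangle>"
      unfolding G_def by blast
    \<comment> \<open>Both derivations are fixed here, so the statement of the induction is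
      bounded.\<close>
    have "\<forall>x. x \<prec> k \<longrightarrow> (\<forall>x'. x' \<prec> k' \<longrightarrow> code_elem k m n \<langle>i, x\<rangle> \<and> code_elem k' m' n' \<langle>i, x'\<rangle> \<longrightarrow> x = x')"
    proof (rule delta0_induct[of "\<lambda>i. \<forall>x. x \<prec> k \<longrightarrow> (\<forall>x'. x' \<prec> k' \<longrightarrow>
        code_elem k m n \<langle>i, x\<rangle> \<and> code_elem k' m' n' \<langle>i, x'\<rangle> \<longrightarrow> x = x')"])
      show "delta0 M (\<lambda>e. \<forall>x. x \<prec> k \<longrightarrow> (\<forall>x'. x' \<prec> k' \<longrightarrow>
          code_elem k m n \<langle>e 0, x\<rangle> \<and> code_elem k' m' n' \<langle>e 0, x'\<rangle> \<longrightarrow> x = x'))" by (intro rules)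
      show "\<forall>x. x \<prec> k \<longrightarrow> (\<forall>x'. x' \<prec> k' \<longrightarrow> code_elem k m n \<langle>\<zero>, x\<rangle> \<and> code_elem k' m' n' \<langle>\<zero>, x'\<rangle> \<longrightarrow> x = x')"
        using derivationD[OF d(1)] derivationD[OF d(2)] suc_neq_zero by metis
      fix i assume IH: "\<forall>x. x \<prec> k \<longrightarrow> (\<forall>x'. x' \<prec> k' \<longrightarrow>
        code_elem k m n \<langle>i, x\<rangle> \<and> code_elem k' m' n' \<langle>i, x'\<rangle> \<longrightarrow> x = x')"
      have "x = x'" if el: "code_elem k m n \<langle>i \<oplus> \<one>, x\<rangle>" "code_elem k' m' n' \<langle>i \<oplus> \<one>, x'\<rangle>" for x x'
      proof -
        from derivationD[OF d(1) el(1)] obtain y where y: "code_elem k m n \<langle>i, y\<rangle>" "R y x"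
          using suc_inject suc_neq_zero by metis
        from derivationD[OF d(2) el(2)] obtain y' where y': "code_elem k' m' n' \<langle>i, y'\<rangle>" "R y' x'"
          using suc_inject suc_neq_zero by metis
        have "y \<prec> k" "y' \<prec> k'"
          using y(1) y'(1) by (blast dest: code_elem_pair_less)+
        with IH y y' have "y = y'" by blast
        with y y' ex1 show ?thesis by blast
      qed
      then show "\<forall>x. x \<prec> k \<longrightarrow> (\<forall>x'. x' \<prec> k' \<longrightarrow>
        code_elem k m n \<langle>i \<oplus> \<one>, x\<rangle> \<and> code_elem k' m' n' \<langle>i \<oplus> \<one>, x'\<rangle> \<longrightarrow> x = x')" by blast
    qed
    moreover have "x \<prec> k" "x' \<prec> k'"
      using el by (blast dest: code_elem_pair_less)+
    ultimately show ?thesis using el by blast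
  qed
  have zero: "G \<zero> a"
  proof -
    have "delta0 M (\<lambda>e. e 0 = \<langle>\<zero>, a\<rangle>)" by (intro rules)
    then obtain m n where "\<And>i. code_elem (\<langle>\<zero>, a\<rangle> \<oplus> \<one>) m n i \<longleftrightarrow> i \<prec> \<langle>\<zero>, a\<rangle> \<oplus> \<one> \<and> i = \<langle>\<zero>, a\<rangle>"
      using finite_set_code[of "\<lambda>i. i = \<langle>\<zero>, a\<rangle>"] by blast
    then show ?thesis unfolding G_def
      by (intro exI[of _ "\<langle>\<zero>, a\<rangle> \<oplus> \<one>"] exI[of _ m] exI[of _ n] conjI derivationI) (auto simp: leq_def)
  qed
  have step: "G (i \<oplus> \<one>) y" if "G i x" "R x y" for i x y
  proof -
    from that obtain k m n where d: "derivation a R k m n" and el: "code_elem k m n \<langle>i, x\<rangle>"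
      unfolding G_def by blast
    \<comment> \<open>Large enough for all old members and for the new pair.\<close>
    let ?k = "k \<oplus> \<langle>i \<oplus> \<one>, y\<rangle> \<oplus> \<one>"
    have "delta0 M (\<lambda>e. code_elem k m n (e 0) \<or> e 0 = \<langle>i \<oplus> \<one>, y\<rangle>)" by (intro rules)
    then obtain m' n' where *: "\<And>p. code_elem ?k m' n' p \<longleftrightarrow> p \<prec> ?k \<and> (code_elem k m n p \<or> p = \<langle>i \<oplus> \<one>, y\<rangle>)"
      using finite_set_code[of "\<lambda>p. code_elem k m n p \<or> p = \<langle>i \<oplus> \<one>, y\<rangle>"] by blast
    have "code_elem k m n p \<Longrightarrow> p \<prec> ?k" for p
      unfolding code_elem_def less_suc_iff by (meson N.order.trans N.order.strict_implies_order leq_add(1))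
    with * have el': "code_elem ?k m' n' p \<longleftrightarrow> code_elem k m n p \<or> p = \<langle>i \<oplus> \<one>, y\<rangle>" for p by auto
    have "derivation a R ?k m' n'"
    proof (rule derivationI)
      fix i' x' assume "code_elem ?k m' n' \<langle>i', x'\<rangle>"
      then consider "code_elem k m n \<langle>i', x'\<rangle>" | "i' = i \<oplus> \<one>" "x' = y" by (auto simp: el')
      then show "i' = \<zero> \<and> x' = a \<or> (\<exists>j y. i' = j \<oplus> \<one> \<and> code_elem ?k m' n' \<langle>j, y\<rangle> \<and> R y x')"
      proof cases
        case 1
        from derivationD[OF d this] show ?thesis unfolding el' by blast
      next
        case 2
        with el that(2) show ?thesis unfolding el' by blast
      qed
    qed
    then show ?thesis unfolding G_def using el' by blast
  qed
  have "\<exists>x. G i x" for i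
  proof (rule sigma1_induct[of "\<lambda>i. \<exists>x. G i x"])
    show "sigma1 M (\<lambda>e. \<exists>x. G (e 0) x)" by (intro sigma1_ex sigma1_subst2[OF G] term_fun.intros)
  qed (use zero step ex1 in blast)+
  with unique have "\<exists>!x. G i x" for i by blast
  from function_exists[OF G this] obtain H where H: "fun_set H" "\<And>i j. \<langle>i, j\<rangle> \<in> H \<longleftrightarrow> G i j" by blast
  show ?thesis
  proof (rule that[OF H(1)])
    show "R x y" if "\<langle>i, x\<rangle> \<in> H" "\<langle>i \<oplus> \<one>, y\<rangle> \<in> H" for i x y
      using that step unique ex1[of x] unfolding H(2) by blast
    show "x = a" if "\<langle>\<zero>, x\<rangle> \<in> H" for x using that zero unique unfolding H(2) by blast
  qed
qed

text \<open>Iterates "next element of \<open>A\<close>" from an arbitrary element of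
  \<open>A\<close>. The result need not exhaust \<open>A\<close>; only strict increase inside
  \<open>A\<close> is claimed.\<close>

lemma increasing_enumeration:
  assumes A: "A \<in> sets M" and inf: "\<And>k. \<exists>j. k \<prec> j \<and> j \<in> A"
  obtains H where "fun_set H" "\<And>i x. \<langle>i, x\<rangle> \<in> H \<Longrightarrow> x \<in> A"
    "\<And>i j x y. i \<prec> j \<Longrightarrow> \<langle>i, x\<rangle> \<in> H \<Longrightarrow> \<langle>j, y\<rangle> \<in> H \<Longrightarrow> x \<prec> y"
proof -
  define R where "R x y \<longleftrightarrow> (x \<prec> y \<and> y \<in> A) \<and> (\<forall>z. z \<prec> y \<longrightarrow> \<not> (x \<prec> z \<and> z \<in> A))" for x y
  obtain a where a: "a \<in> A" using inf by blast
  have dR: "delta0 M (\<lambda>e. R (e 0) (e 1))" unfolding R_def by (intro delta0_rules A)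
  have "\<exists>!y. R x y" for x
  proof -
    from inf obtain y0 where "x \<prec> y0 \<and> y0 \<in> A" by blast
    moreover have "delta0 M (\<lambda>e. x \<prec> e 0 \<and> e 0 \<in> A)" by (intro delta0_rules A)
    ultimately obtain y where "x \<prec> y \<and> y \<in> A" "\<And>k. k \<prec> y \<Longrightarrow> \<not> (x \<prec> k \<and> k \<in> A)"
      using least_number[of "\<lambda>y. x \<prec> y \<and> y \<in> A" y0] by blast
    then show ?thesis unfolding R_def by (intro ex1I[of _ y]) (auto, metis N.neq_iff)
  qed
  then obtain H where H: "fun_set H"
    and step: "\<And>i x y. \<langle>i, x\<rangle> \<in> H \<Longrightarrow> \<langle>i \<oplus> \<one>, y\<rangle> \<in> H \<Longrightarrow> R x y"
    and start: "\<And>x. \<langle>\<zero>, x\<rangle> \<in> H \<Longrightarrow> x = a"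
    by (rule iteration[OF dR]) (rule that)
  from H have tot: "\<exists>x. \<langle>i, x\<rangle> \<in> H" and fn: "\<langle>i, x\<rangle> \<in> H \<Longrightarrow> \<langle>i, y\<rangle> \<in> H \<Longrightarrow> x = y"
    and Hs: "H \<in> sets M" for i x y
    unfolding fun_set_def by blast+
  show ?thesis
  proof (rule that[OF H])
    show "x \<in> A" if "\<langle>i, x\<rangle> \<in> H" for i x
    proof (cases "i = \<zero>")
      case True
      with that start a show ?thesis by blast
    next
      case False
      then obtain j where "i = j \<oplus> \<one>" using zero_or_suc by blast
      with that tot[of j] step show ?thesis unfolding R_def by blast
    qed
    fix i j x y assume ij: "i \<prec> j" and x: "\<langle>i, x\<rangle> \<in> H" and y: "\<langle>j, y\<rangle> \<in> H"
    \<comment> \<open>Induction on the distance of the indices; quantifying the value existentially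
      keeps the statement Sigma_1.\<close>
    have "\<exists>y. \<langle>i \<oplus> (d \<oplus> \<one>), y\<rangle> \<in> H \<and> x \<prec> y" for d
    proof (rule sigma1_induct[of "\<lambda>d. \<exists>y. \<langle>i \<oplus> (d \<oplus> \<one>), y\<rangle> \<in> H \<and> x \<prec> y"])
      show "sigma1 M (\<lambda>e. \<exists>y. \<langle>i \<oplus> (e 0 \<oplus> \<one>), y\<rangle> \<in> H \<and> x \<prec> y)"
        by (intro sigma1_ex_delta0 delta0_rules Hs)
      show "\<exists>y. \<langle>i \<oplus> (\<zero> \<oplus> \<one>), y\<rangle> \<in> H \<and> x \<prec> y"
        using tot step[OF x] unfolding zero_add R_def by blast
      fix d assume "\<exists>y. \<langle>i \<oplus> (d \<oplus> \<one>), y\<rangle> \<in> H \<and> x \<prec> y"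
      then obtain y where y: "\<langle>i \<oplus> (d \<oplus> \<one>), y\<rangle> \<in> H" "x \<prec> y" by blast
      obtain z where z: "\<langle>i \<oplus> (d \<oplus> \<one> \<oplus> \<one>), z\<rangle> \<in> H" using tot by blast
      have "R y z" using step[OF y(1)] z unfolding add_suc[of i "d \<oplus> \<one>"] by blast
      with y z show "\<exists>y. \<langle>i \<oplus> (d \<oplus> \<one> \<oplus> \<one>), y\<rangle> \<in> H \<and> x \<prec> y" unfolding R_def by (metis N.order.strict_trans)
    qed
    moreover obtain d where "j = i \<oplus> (d \<oplus> \<one>)" using ij less_iff_add by blast
    ultimately show "x \<prec> y" using fn y by metis
  qed
qed

end

section \<open>Meaning of the formulas in a model\<close>

lemma sat_cong:
  "(\<And>x. x \<in> fv \<phi> \<Longrightarrow> e x = e' x) \<Longrightarrow> sat M e E \<phi> \<longleftrightarrow> sat M e' E \<phi>"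
proof (induction \<phi> arbitrary: e e' E)
  case (Forall x \<phi>)
  have "sat M (e(x := a)) E \<phi> \<longleftrightarrow> sat M (e'(x := a)) E \<phi>" for a
    by (rule Forall.IH) (use Forall.prems in auto)
  then show ?case by simp
next
  case (Exists x \<phi>)
  have "sat M (e(x := a)) E \<phi> \<longleftrightarrow> sat M (e'(x := a)) E \<phi>" for a
    by (rule Exists.IH) (use Exists.prems in auto)
  then show ?case by simp
next
  case (ForallS X \<phi>)
  have "sat M e (E(X := A)) \<phi> \<longleftrightarrow> sat M e' (E(X := A)) \<phi>" for A
    by (rule ForallS.IH) (use ForallS.prems in auto)
  then show ?case by simp
next
  case (ExistsS X \<phi>)
  have "sat M e (E(X := A)) \<phi> \<longleftrightarrow> sat M e' (E(X := A)) \<phi>" for A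
    by (rule ExistsS.IH) (use ExistsS.prems in auto)
  then show ?case by simp
next
  case (Eq s t)
  then have "eval M e s = eval M e' s" "eval M e t = eval M e' t" by (auto intro: eval_cong)
  then show ?case by simp
next
  case (Less s t)
  then have "eval M e s = eval M e' s" "eval M e t = eval M e' t" by (auto intro: eval_cong)
  then show ?case by simp
next
  case (Mem t X)
  then have "eval M e t = eval M e' t" by (auto intro: eval_cong)
  then show ?case by simp
next
  case (Neg \<phi>)
  have "sat M e E \<phi> \<longleftrightarrow> sat M e' E \<phi>" by (rule Neg.IH) (use Neg.prems in auto)
  then show ?case by simp
next
  case (Conj \<phi> \<psi>)
  have "sat M e E \<phi> \<longleftrightarrow> sat M e' E \<phi>" by (rule Conj.IH(1)) (use Conj.prems in auto)
  moreover have "sat M e E \<psi> \<longleftrightarrow> sat M e' E \<psi>" by (rule Conj.IH(2)) (use Conj.prems in auto)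
  ultimately show ?case by simp
next
  case (Disj \<phi> \<psi>)
  have "sat M e E \<phi> \<longleftrightarrow> sat M e' E \<phi>" by (rule Disj.IH(1)) (use Disj.prems in auto)
  moreover have "sat M e E \<psi> \<longleftrightarrow> sat M e' E \<psi>" by (rule Disj.IH(2)) (use Disj.prems in auto)
  ultimately show ?case by simp
next
  case (Imp \<phi> \<psi>)
  have "sat M e E \<phi> \<longleftrightarrow> sat M e' E \<phi>" by (rule Imp.IH(1)) (use Imp.prems in auto)
  moreover have "sat M e E \<psi> \<longleftrightarrow> sat M e' E \<psi>" by (rule Imp.IH(2)) (use Imp.prems in auto)
  ultimately show ?case by simp
next
  case (Iff \<phi> \<psi>)
  have "sat M e E \<phi> \<longleftrightarrow> sat M e' E \<phi>" by (rule Iff.IH(1)) (use Iff.prems in auto)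
  moreover have "sat M e E \<psi> \<longleftrightarrow> sat M e' E \<psi>" by (rule Iff.IH(2)) (use Iff.prems in auto)
  ultimately show ?case by simp
qed

lemma eval_pr [simp]: "eval M e (pr s t) = pair M (eval M e s) (eval M e t)"
  by (simp add: pr_def pair_def)

lemma sat_Le [simp]: "sat M e E (s \<^bold>\<le> t) \<longleftrightarrow> leq M (eval M e s) (eval M e t)"
  by (simp add: Le_def leq_def)

context rca0_model
begin

definition quasi_order :: "'a set \<Rightarrow> 'a set \<Rightarrow> bool" where
  "quasi_order Q R \<longleftrightarrow> (\<forall>p. p \<in> R \<longrightarrow> (\<exists>a b. a \<in> Q \<and> b \<in> Q \<and> p = \<langle>a, b\<rangle>)) \<and>
    (\<forall>a. a \<in> Q \<longrightarrow> \<langle>a, a\<rangle> \<in> R) \<and>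
    (\<forall>a b c. \<langle>a, b\<rangle> \<in> R \<and> \<langle>b, c\<rangle> \<in> R \<longrightarrow> \<langle>a, c\<rangle> \<in> R)"

definition wqo :: "'a set \<Rightarrow> 'a set \<Rightarrow> bool" where
  "wqo Q R \<longleftrightarrow> quasi_order Q R \<and>
    (\<forall>F. fun_set F \<and> (\<forall>i a. \<langle>i, a\<rangle> \<in> F \<longrightarrow> a \<in> Q) \<longrightarrow>
      (\<exists>i j a b. i \<prec> j \<and> \<langle>i, a\<rangle> \<in> F \<and> \<langle>j, b\<rangle> \<in> F \<and> \<langle>a, b\<rangle> \<in> R))"

definition times_set :: "'a \<Rightarrow> 'a set \<Rightarrow> 'a set" where
  "times_set n Q = {p. \<exists>m q. p = \<langle>m, q\<rangle> \<and> m \<prec> n \<and> q \<in> Q}"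

text \<open>The quantifiers are nested so that pairs are opened one at a time, as
  \<open>delta0_bex_pair\<close> requires.\<close>

definition times_order :: "('a \<Rightarrow> 'a \<Rightarrow> bool) \<Rightarrow> 'a \<Rightarrow> 'a set \<Rightarrow> 'a set \<Rightarrow> 'a set" where
  "times_order cmp n Q R = {p. \<exists>x y. p = \<langle>x, y\<rangle> \<and> (\<exists>m1 q1. x = \<langle>m1, q1\<rangle> \<and> (\<exists>m2 q2. y = \<langle>m2, q2\<rangle> \<and>
    m1 \<prec> n \<and> q1 \<in> Q \<and> m2 \<prec> n \<and> q2 \<in> Q \<and> cmp m1 m2 \<and> \<langle>q1, q2\<rangle> \<in> R))}"

lemma pair_mem_times_set [simp]: "\<langle>m, q\<rangle> \<in> times_set n Q \<longleftrightarrow> m \<prec> n \<and> q \<in> Q"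
  by (auto simp: times_set_def)

lemma pair_mem_times_order [simp]:
  "\<langle>\<langle>m1, q1\<rangle>, \<langle>m2, q2\<rangle>\<rangle> \<in> times_order cmp n Q R \<longleftrightarrow>
    m1 \<prec> n \<and> q1 \<in> Q \<and> m2 \<prec> n \<and> q2 \<in> Q \<and> cmp m1 m2 \<and> \<langle>q1, q2\<rangle> \<in> R"
  by (auto simp: times_order_def)

definition wqo_product :: "('a \<Rightarrow> 'a \<Rightarrow> bool) \<Rightarrow> bool" where
  "wqo_product cmp \<longleftrightarrow> (\<forall>n. \<forall>Q\<in>sets M. \<forall>R\<in>sets M. wqo Q R \<longrightarrow> wqo (times_set n Q) (times_order cmp n Q R))"

definition pigeonhole :: bool where
  "pigeonhole \<longleftrightarrow> (\<forall>n F. fun_set F \<and> (\<forall>j i. \<langle>j, i\<rangle> \<in> F \<longrightarrow> i \<prec> n) \<longrightarrow>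
    (\<exists>A\<in>sets M. \<exists>i. (\<forall>k. \<exists>j. k \<prec> j \<and> j \<in> A) \<and> i \<prec> n \<and> (\<forall>j. j \<in> A \<longrightarrow> \<langle>j, i\<rangle> \<in> F)))"

lemma sat_is_function: "E F \<in> sets M \<Longrightarrow> sat M e E (is_function F) \<longleftrightarrow> fun_set (E F)"
  by (simp add: is_function_def fun_set_def Let_def)

lemma sat_is_quasi_order: "sat M e E (is_quasi_order Q R) \<longleftrightarrow> quasi_order (E Q) (E R)"
  by (simp add: is_quasi_order_def quasi_order_def Let_def)

lemma sat_is_wqo: "Q \<noteq> ''F'' \<Longrightarrow> R \<noteq> ''F'' \<Longrightarrow> sat M e E (is_wqo Q R) \<longleftrightarrow> wqo (E Q) (E R)"
  by (auto simp: is_wqo_def wqo_def Let_def sat_is_quasi_order sat_is_function fun_set_def)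

lemma sat_is_times: "sat M e E (is_times P Q) \<longleftrightarrow> E P = times_set (e ''n'') (E Q)"
  by (auto simp: is_times_def Let_def times_set_def)

lemma sat_is_times_order:
  assumes "\<And>s t e E. sat M e E (cmp s t) \<longleftrightarrow> c (eval M e s) (eval M e t)"
  shows "sat M e E (is_times_order cmp S Q R) \<longleftrightarrow> E S = times_order c (e ''n'') (E Q) (E R)"
  by (auto simp: is_times_order_def Let_def times_order_def assms)

lemma models_closed:
  assumes "\<And>e E. sat M e E \<phi> \<longleftrightarrow> P"
  shows "M \<^bold>\<Turnstile> {\<phi>} \<longleftrightarrow> P"
  using sets_nonempty by (auto simp: models_def assms)

lemma models_RT1: "M \<^bold>\<Turnstile> {RT1} \<longleftrightarrow> pigeonhole"
proof (rule models_closed)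
  show "sat M e E RT1 \<longleftrightarrow> pigeonhole" for e E
    unfolding pigeonhole_def RT1_def Let_def by (simp add: sat_is_function) (auto simp: fun_set_def)
qed

text \<open>\<open>WQP\<close> asks for sets \<open>P\<close> and \<open>S\<close>, but their
  defining conditions determine them and bounded comprehension provides them, so these two
  quantifiers disappear.\<close>

lemma models_WQP:
  assumes cmp: "\<And>s t e E. sat M e E (cmp s t) \<longleftrightarrow> c (eval M e s) (eval M e t)"
    and c: "delta0 M (\<lambda>e. c (e 0) (e 1))"
  shows "M \<^bold>\<Turnstile> {WQP cmp} \<longleftrightarrow> wqo_product c"
proof (rule models_closed)
  have P: "times_set n Q \<in> sets M" if "Q \<in> sets M" for n Q
    unfolding times_set_def
    by (intro delta0_comprehension delta0_bex_pair delta0_rules that)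
  have S: "times_order c n Q R \<in> sets M" if "Q \<in> sets M" "R \<in> sets M" for n Q R
    unfolding times_order_def
    by (intro delta0_comprehension delta0_bex_pair delta0_rules delta0_subst2[OF c] that)
  show "sat M e E (WQP cmp) \<longleftrightarrow> wqo_product c" for e E
    unfolding WQP_def wqo_product_def
    by (simp add: sat_is_wqo sat_is_times sat_is_times_order[where cmp=cmp and c=c, OF cmp] P S)
qed

lemma models_WQP_disjoint_union: "M \<^bold>\<Turnstile> {WQP_disjoint_union} \<longleftrightarrow> wqo_product (=)"
  unfolding WQP_disjoint_union_def by (rule models_WQP) (simp, intro delta0_rules)

lemma models_WQP_product: "M \<^bold>\<Turnstile> {WQP_product} \<longleftrightarrow> wqo_product (\<preceq>)"
  unfolding WQP_product_def by (rule models_WQP) (simp, intro delta0_rules)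

section \<open>The implications\<close>

lemma quasi_order_times:
  assumes "quasi_order Q R" "\<And>a. c a a" "\<And>a b d. c a b \<Longrightarrow> c b d \<Longrightarrow> c a d"
  shows "quasi_order (times_set n Q) (times_order c n Q R)"
  unfolding quasi_order_def
proof (intro conjI allI impI)
  show "\<exists>a b. a \<in> times_set n Q \<and> b \<in> times_set n Q \<and> p = \<langle>a, b\<rangle>" if "p \<in> times_order c n Q R" for p
    using that unfolding times_order_def by fastforce
  show "\<langle>a, a\<rangle> \<in> times_order c n Q R" if "a \<in> times_set n Q" for a
  proof -
    from that obtain m q where "a = \<langle>m, q\<rangle>" "m \<prec> n" "q \<in> Q" unfolding times_set_def by blast
    moreover have "\<langle>q, q\<rangle> \<in> R" using \<open>q \<in> Q\<close> assms(1) unfolding quasi_order_def by blast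
    ultimately show ?thesis using assms(2) by simp
  qed
  show "\<langle>x, z\<rangle> \<in> times_order c n Q R"
    if "\<langle>x, y\<rangle> \<in> times_order c n Q R \<and> \<langle>y, z\<rangle> \<in> times_order c n Q R" for x y z
  proof -
    from that obtain m1 q1 m2 q2 where xy: "x = \<langle>m1, q1\<rangle>" "y = \<langle>m2, q2\<rangle>"
      unfolding times_order_def by auto
    from that obtain m3 q3 where z: "z = \<langle>m3, q3\<rangle>" unfolding times_order_def by auto
    from that have *: "m1 \<prec> n" "q1 \<in> Q" "m3 \<prec> n" "q3 \<in> Q" "c m1 m2" "c m2 m3" "\<langle>q1, q2\<rangle> \<in> R" "\<langle>q2, q3\<rangle> \<in> R"
      unfolding xy z by simp_all
    then have "\<langle>q1, q3\<rangle> \<in> R" using assms(1) unfolding quasi_order_def by blast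
    moreover have "c m1 m3" using assms(3) * by blast
    ultimately show ?thesis unfolding xy z using * by simp
  qed
qed

text \<open>Both orders live on the same set and one contains the other; a good pair for the smaller
  is good for the larger.\<close>

lemma wqo_product_leq_if_eq:
  assumes "wqo_product (=)"
  shows "wqo_product (\<preceq>)"
  unfolding wqo_product_def
proof (intro allI ballI impI)
  fix n Q R assume QR: "Q \<in> sets M" "R \<in> sets M" "wqo Q R"
  have sub: "times_order (=) n Q R \<subseteq> times_order (\<preceq>) n Q R"
    unfolding times_order_def using N.order.refl by blast
  have "quasi_order Q R" using QR(3) by (simp add: wqo_def)
  then have "quasi_order (times_set n Q) (times_order (\<preceq>) n Q R)"
    by (rule quasi_order_times) auto
  moreover have "wqo (times_set n Q) (times_order (=) n Q R)"
    using assms QR unfolding wqo_product_def by blast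
  ultimately show "wqo (times_set n Q) (times_order (\<preceq>) n Q R)"
    using sub unfolding wqo_def by (meson subsetD)
qed

lemma wqo_product_eq_if_pigeonhole:
  assumes pigeonhole
  shows "wqo_product (=)"
  unfolding wqo_product_def
proof (intro allI ballI impI)
  fix n Q R assume QR: "Q \<in> sets M" "R \<in> sets M" "wqo Q R"
  have qo: "quasi_order Q R" using QR(3) by (simp add: wqo_def)
  show "wqo (times_set n Q) (times_order (=) n Q R)"
    unfolding wqo_def
  proof (intro conjI allI impI)
    show "quasi_order (times_set n Q) (times_order (=) n Q R)"
      by (rule quasi_order_times[OF qo]) auto
    fix F assume F: "fun_set F \<and> (\<forall>i a. \<langle>i, a\<rangle> \<in> F \<longrightarrow> a \<in> times_set n Q)"
    then have Fs: "F \<in> sets M" and Fun: "\<And>i x y. \<langle>i, x\<rangle> \<in> F \<Longrightarrow> \<langle>i, y\<rangle> \<in> F \<Longrightarrow> x = y"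
      unfolding fun_set_def by blast+
    have Ftot: "\<exists>m q. \<langle>i, \<langle>m, q\<rangle>\<rangle> \<in> F \<and> m \<prec> n \<and> q \<in> Q" for i
      using F unfolding fun_set_def times_set_def by blast
    \<comment> \<open>\<open>C\<close> colours each index by the first component of its
      term.\<close>
    have "sigma1 M (\<lambda>e. \<exists>q. \<langle>e 0, \<langle>e 1, q\<rangle>\<rangle> \<in> F)" by (intro sigma1_ex_delta0 delta0_rules Fs)
    moreover have "\<exists>!m. \<exists>q. \<langle>j, \<langle>m, q\<rangle>\<rangle> \<in> F" for j
      using Ftot[of j] Fun by fastforce
    ultimately obtain C where C: "fun_set C" "\<And>j m. \<langle>j, m\<rangle> \<in> C \<longleftrightarrow> (\<exists>q. \<langle>j, \<langle>m, q\<rangle>\<rangle> \<in> F)"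
      by (rule function_exists) (rule that)
    have "m \<prec> n" if "\<langle>j, m\<rangle> \<in> C" for j m
      using that F unfolding C(2) by (metis pair_mem_times_set)
    with assms C(1) obtain A c where A: "A \<in> sets M" "\<And>k. \<exists>j. k \<prec> j \<and> j \<in> A"
      and c: "c \<prec> n" "\<And>j. j \<in> A \<Longrightarrow> \<langle>j, c\<rangle> \<in> C"
      unfolding pigeonhole_def by blast
    obtain H where H: "fun_set H" "\<And>i x. \<langle>i, x\<rangle> \<in> H \<Longrightarrow> x \<in> A"
      "\<And>i j x y. i \<prec> j \<Longrightarrow> \<langle>i, x\<rangle> \<in> H \<Longrightarrow> \<langle>j, y\<rangle> \<in> H \<Longrightarrow> x \<prec> y"
      by (rule increasing_enumeration[OF A]) (rule that)
    have Hs: "H \<in> sets M" and Htot: "\<exists>x. \<langle>i, x\<rangle> \<in> H"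
      and Hun: "\<langle>i, x\<rangle> \<in> H \<Longrightarrow> \<langle>i, y\<rangle> \<in> H \<Longrightarrow> x = y" for i x y
      using H(1) unfolding fun_set_def by blast+
    \<comment> \<open>\<open>K\<close> will be the subsequence of \<open>F\<close> along
      \<open>H\<close>, stripped of its constant first component c: a sequence in
      \<open>Q\<close>.\<close>
    have "sigma1 M (\<lambda>e. \<exists>x. \<langle>e 0, x\<rangle> \<in> H \<and> \<langle>x, \<langle>c, e 1\<rangle>\<rangle> \<in> F)"
      by (intro sigma1_ex_delta0 delta0_rules Hs Fs)
    moreover have "\<exists>!q. \<exists>x. \<langle>k, x\<rangle> \<in> H \<and> \<langle>x, \<langle>c, q\<rangle>\<rangle> \<in> F" for k
    proof -
      obtain x where x: "\<langle>k, x\<rangle> \<in> H" using Htot by blast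
      with H(2) c(2) C(2) obtain q where q: "\<langle>x, \<langle>c, q\<rangle>\<rangle> \<in> F" by blast
      show ?thesis
      proof (rule ex1I[of _ q])
        show "\<exists>x. \<langle>k, x\<rangle> \<in> H \<and> \<langle>x, \<langle>c, q\<rangle>\<rangle> \<in> F" using x q by blast
        fix q' assume "\<exists>x. \<langle>k, x\<rangle> \<in> H \<and> \<langle>x, \<langle>c, q'\<rangle>\<rangle> \<in> F"
        then have "\<langle>x, \<langle>c, q'\<rangle>\<rangle> \<in> F" using Hun[OF x] by blast
        then have "\<langle>c, q\<rangle> = \<langle>c, q'\<rangle>" by (rule Fun[OF q])
        then show "q' = q" by simp
      qed
    qed
    ultimately obtain K where K: "fun_set K"
      "\<And>k q. \<langle>k, q\<rangle> \<in> K \<longleftrightarrow> (\<exists>x. \<langle>k, x\<rangle> \<in> H \<and> \<langle>x, \<langle>c, q\<rangle>\<rangle> \<in> F)"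
      by (rule function_exists) (rule that)
    have KQ: "q \<in> Q" if "\<langle>k, q\<rangle> \<in> K" for k q using that F unfolding K(2) by (metis pair_mem_times_set)
    with QR(3) K(1) obtain k k' q q' where good: "k \<prec> k'" "\<langle>k, q\<rangle> \<in> K" "\<langle>k', q'\<rangle> \<in> K" "\<langle>q, q'\<rangle> \<in> R"
      unfolding wqo_def by blast
    then obtain x x' where x: "\<langle>k, x\<rangle> \<in> H" "\<langle>x, \<langle>c, q\<rangle>\<rangle> \<in> F" "\<langle>k', x'\<rangle> \<in> H" "\<langle>x', \<langle>c, q'\<rangle>\<rangle> \<in> F"
      unfolding K(2) by blast
    \<comment> \<open>Here the enumeration must be increasing: the good pair of \<open>K\<close>
      comes from positions of \<open>F\<close> in the right order.\<close>
    have "x \<prec> x'" using H(3) good(1) x by blast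
    moreover have "\<langle>\<langle>c, q\<rangle>, \<langle>c, q'\<rangle>\<rangle> \<in> times_order (=) n Q R"
      using c(1) KQ good by simp
    ultimately show "\<exists>i j a b. i \<prec> j \<and> \<langle>i, a\<rangle> \<in> F \<and> \<langle>j, b\<rangle> \<in> F \<and> \<langle>a, b\<rangle> \<in> times_order (=) n Q R"
      using x by blast
  qed
qed

text \<open>Order the numbers by \<open>j \<le> k\<close> iff \<open>(f k, k)\<close> is lexicographically at most \<open>(f j, j)\<close>. The sequence
  of the pairs \<open>(f j, j)\<close> is bad in the product, and a bad sequence for this order eventually
  stays in one colour class, in which it increases.\<close>

lemma pigeonhole_if_wqo_product_leq:
  assumes "wqo_product (\<preceq>)"
  shows pigeonhole
  unfolding pigeonhole_def
proof (intro allI impI)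
  fix n F assume F: "fun_set F \<and> (\<forall>j i. \<langle>j, i\<rangle> \<in> F \<longrightarrow> i \<prec> n)"
  then have Fs: "F \<in> sets M" and Ftot: "\<And>i. \<exists>c. \<langle>i, c\<rangle> \<in> F" and Fn: "\<And>i c. \<langle>i, c\<rangle> \<in> F \<Longrightarrow> c \<prec> n"
    and Fun: "\<And>i x y. \<langle>i, x\<rangle> \<in> F \<Longrightarrow> \<langle>i, y\<rangle> \<in> F \<Longrightarrow> x = y"
    unfolding fun_set_def by blast+
  \<comment> \<open>Colours are below n, so the quantifiers over them are bounded and the order is a
    set of the model.\<close>
  define T where "T j k \<longleftrightarrow> (\<exists>a. a \<prec> n \<and> (\<exists>b. b \<prec> n \<and> (\<langle>j, a\<rangle> \<in> F \<and> \<langle>k, b\<rangle> \<in> F \<and>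
    (b \<prec> a \<or> a = b \<and> k \<preceq> j))))" for j k
  have T: "T j k \<longleftrightarrow> b \<prec> a \<or> a = b \<and> k \<preceq> j" if "\<langle>j, a\<rangle> \<in> F" "\<langle>k, b\<rangle> \<in> F" for j k a b
    unfolding T_def using that Fn Fun by blast
  define R where "R = {p. \<exists>j k. p = \<langle>j, k\<rangle> \<and> T j k}"
  have R: "\<langle>j, k\<rangle> \<in> R \<longleftrightarrow> T j k" for j k by (simp add: R_def)
  have Rs: "R \<in> sets M"
    unfolding R_def T_def by (intro relation_exists delta0_rules Fs)
  have Us: "UNIV \<in> sets M" unfolding UNIV_def by (rule delta0_comprehension[OF delta0_bool])
  have "\<not> wqo UNIV R"
  proof
    assume "wqo UNIV R"
    with assms Us Rs have wqo: "wqo (times_set n UNIV) (times_order (\<preceq>) n UNIV R)"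
      unfolding wqo_product_def by blast
    have "sigma1 M (\<lambda>e. \<exists>c. e 1 = \<langle>c, e 0\<rangle> \<and> \<langle>e 0, c\<rangle> \<in> F)" by (intro sigma1_ex_delta0 delta0_rules Fs)
    moreover have "\<exists>!p. \<exists>c. p = \<langle>c, j\<rangle> \<and> \<langle>j, c\<rangle> \<in> F" for j using Ftot[of j] Fun by fastforce
    ultimately obtain K where K: "fun_set K" "\<And>j p. \<langle>j, p\<rangle> \<in> K \<longleftrightarrow> (\<exists>c. p = \<langle>c, j\<rangle> \<and> \<langle>j, c\<rangle> \<in> F)"
      by (rule function_exists) (rule that)
    have "a \<in> times_set n UNIV" if "\<langle>i, a\<rangle> \<in> K" for i a using that Fn unfolding K(2) by auto
    with wqo K(1) obtain i j x y where "i \<prec> j" "\<langle>i, x\<rangle> \<in> K" "\<langle>j, y\<rangle> \<in> K" "\<langle>x, y\<rangle> \<in> times_order (\<preceq>) n UNIV R"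
      unfolding wqo_def by blast
    then obtain a b where ab: "i \<prec> j" "\<langle>i, a\<rangle> \<in> F" "\<langle>j, b\<rangle> \<in> F" "a \<preceq> b" "T i j"
      unfolding K(2) by (auto simp: R)
    \<comment> \<open>\<open>T i j\<close> requires the colour to drop, excluded by
      \<open>a \<preceq> b\<close>, or \<open>j \<preceq> i\<close>, excluded by
      \<open>i \<prec> j\<close>.\<close>
    then show False using T[OF ab(2,3)] by (metis N.not_le)
  qed
  moreover have "quasi_order UNIV R"
    unfolding quasi_order_def
  proof (intro conjI allI impI)
    show "\<langle>a, a\<rangle> \<in> R" for a using Ftot[of a] T by (auto simp: R)
    show "\<langle>x, z\<rangle> \<in> R" if "\<langle>x, y\<rangle> \<in> R \<and> \<langle>y, z\<rangle> \<in> R" for x y z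
    proof -
      from Ftot obtain a b c where "\<langle>x, a\<rangle> \<in> F" "\<langle>y, b\<rangle> \<in> F" "\<langle>z, c\<rangle> \<in> F" by blast
      with that show ?thesis unfolding R by (auto simp: T)
    qed
  qed (auto simp: R_def)
  ultimately obtain K where K: "fun_set K"
    and bad: "\<And>i j x y. i \<prec> j \<Longrightarrow> \<langle>i, x\<rangle> \<in> K \<Longrightarrow> \<langle>j, y\<rangle> \<in> K \<Longrightarrow> \<not> T x y"
    unfolding wqo_def R by blast
  then have Ks: "K \<in> sets M" and Ktot: "\<And>i. \<exists>x. \<langle>i, x\<rangle> \<in> K"
    and Kun: "\<And>i x y. \<langle>i, x\<rangle> \<in> K \<Longrightarrow> \<langle>i, y\<rangle> \<in> K \<Longrightarrow> x = y"
    unfolding fun_set_def by blast+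
  define colour where "colour c \<longleftrightarrow> (\<exists>i x. \<langle>i, x\<rangle> \<in> K \<and> \<langle>x, c\<rangle> \<in> F)" for c
  have "sigma1 M (\<lambda>e. colour (e 0))" unfolding colour_def
    by (intro sigma1_ex sigma1_delta0 delta0_rules Ks Fs)
  moreover obtain c0 where "colour c0" unfolding colour_def using Ktot Ftot by blast
  moreover have "c \<preceq> n" if "colour c" for c
    using that Fn unfolding colour_def leq_def by blast
  \<comment> \<open>Colours never decrease along a bad sequence, so once the largest occurring
    colour has appeared, all later terms have it.\<close>
  ultimately obtain c where c: "colour c" "\<And>d. colour d \<Longrightarrow> d \<preceq> c"
    using sigma1_maximum[of colour c0 n] by blast
  then obtain i0 x0 where i0: "\<langle>i0, x0\<rangle> \<in> K" "\<langle>x0, c\<rangle> \<in> F" unfolding colour_def by blast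
  \<comment> \<open>Within one colour a bad sequence increases strictly; the conjunct
    \<open>d \<preceq> x\<close> records this and makes the colour class unbounded.\<close>
  have large: "\<exists>x. \<langle>i0 \<oplus> d, x\<rangle> \<in> K \<and> \<langle>x, c\<rangle> \<in> F \<and> d \<preceq> x" for d
  proof (rule sigma1_induct[of "\<lambda>d. \<exists>x. \<langle>i0 \<oplus> d, x\<rangle> \<in> K \<and> \<langle>x, c\<rangle> \<in> F \<and> d \<preceq> x"])
    show "sigma1 M (\<lambda>e. \<exists>x. \<langle>i0 \<oplus> e 0, x\<rangle> \<in> K \<and> \<langle>x, c\<rangle> \<in> F \<and> e 0 \<preceq> x)"
      by (intro sigma1_ex_delta0 delta0_rules Ks Fs)
    show "\<exists>x. \<langle>i0 \<oplus> \<zero>, x\<rangle> \<in> K \<and> \<langle>x, c\<rangle> \<in> F \<and> \<zero> \<preceq> x" using i0 by auto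
    fix d assume "\<exists>x. \<langle>i0 \<oplus> d, x\<rangle> \<in> K \<and> \<langle>x, c\<rangle> \<in> F \<and> d \<preceq> x"
    then obtain x where x: "\<langle>i0 \<oplus> d, x\<rangle> \<in> K" "\<langle>x, c\<rangle> \<in> F" "d \<preceq> x" by blast
    obtain y where y: "\<langle>i0 \<oplus> (d \<oplus> \<one>), y\<rangle> \<in> K" using Ktot by blast
    obtain b where b: "\<langle>y, b\<rangle> \<in> F" using Ftot by blast
    have "i0 \<oplus> d \<prec> i0 \<oplus> (d \<oplus> \<one>)" unfolding add_suc less_suc_iff by (simp add: leq_def)
    from bad[OF this x(1) y] have "\<not> (b \<prec> c \<or> c = b \<and> y \<preceq> x)" using T x(2) b by blast
    moreover have "b \<preceq> c" using c(2) y b unfolding colour_def by blast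
    ultimately have "b = c" "x \<prec> y" by (metis N.not_le leq_def)+
    with x y b show "\<exists>x. \<langle>i0 \<oplus> (d \<oplus> \<one>), x\<rangle> \<in> K \<and> \<langle>x, c\<rangle> \<in> F \<and> d \<oplus> \<one> \<preceq> x"
      unfolding suc_leq_iff by (metis N.order.strict_trans1)
  qed
  show "\<exists>A\<in>sets M. \<exists>i. (\<forall>k. \<exists>j. k \<prec> j \<and> j \<in> A) \<and> i \<prec> n \<and> (\<forall>j. j \<in> A \<longrightarrow> \<langle>j, i\<rangle> \<in> F)"
  proof (rule bexI[of _ "{j. \<langle>j, c\<rangle> \<in> F}"], rule exI[of _ c], intro conjI allI)
    show "\<exists>j. k \<prec> j \<and> j \<in> {j. \<langle>j, c\<rangle> \<in> F}" for k
      using large[of "k \<oplus> \<one>"] unfolding suc_leq_iff by blast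
    show "c \<prec> n" using Fn i0 by blast
    show "{j. \<langle>j, c\<rangle> \<in> F} \<in> sets M" by (intro delta0_comprehension delta0_rules Fs)
  qed simp
qed

lemma pigeonhole_if_bounding:
  assumes "M \<^bold>\<Turnstile> BSigma02"
  shows pigeonhole
  unfolding pigeonhole_def
proof (intro allI impI)
  fix n F assume F: "fun_set F \<and> (\<forall>j i. \<langle>j, i\<rangle> \<in> F \<longrightarrow> i \<prec> n)"
  then have Fs: "F \<in> sets M" and Ftot: "\<And>i. \<exists>c. \<langle>i, c\<rangle> \<in> F" and Fn: "\<And>i c. \<langle>i, c\<rangle> \<in> F \<Longrightarrow> c \<prec> n"
    unfolding fun_set_def by blast+
  \<comment> \<open>The scheme speaks of all \<open>x \<preceq> a\<close>, so the n colours are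
    taken as the numbers up to a = n - 1; n is positive because 0 has a colour below it.\<close>
  obtain a where n: "n = a \<oplus> \<one>"
    using zero_or_suc[of n] Ftot[of \<zero>] Fn not_less_zero by blast
  \<comment> \<open>The statement about \<open>y\<close> is Pi_1; the vacuous quantifier over
    \<open>u\<close> gives it the form of \<open>Sigma02\<close>.\<close>
  define \<phi> where "\<phi> = (\<^bold>\<exists>''u''. \<^bold>\<forall>''v''. Var ''y'' \<^bold>< Var ''v'' \<^bold>\<longrightarrow> \<^bold>\<not> (pr (Var ''v'') (Var ''x'') \<^bold>\<in> ''F''))"
  have "\<phi> \<in> Sigma02"
    unfolding \<phi>_def Sigma02_def Pi01_def by (auto intro: bounded_fm.intros)
  moreover have "''z'' \<notin> fv \<phi>" by (simp add: \<phi>_def pr_def)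
  ultimately have "((\<^bold>\<forall>''x''. Var ''x'' \<^bold>\<le> Var ''a'' \<^bold>\<longrightarrow> (\<^bold>\<exists>''y''. \<phi>)) \<^bold>\<longrightarrow>
      (\<^bold>\<exists>''z''. \<^bold>\<forall>''x''. Var ''x'' \<^bold>\<le> Var ''a'' \<^bold>\<longrightarrow> (\<^bold>\<exists>''y''. Var ''y'' \<^bold>\<le> Var ''z'' \<^bold>\<and> \<phi>))) \<in> BSigma02"
    unfolding BSigma02_def by (intro CollectI exI conjI) (rule refl, auto)
  \<comment> \<open>A constant assignment serves: all set variables denote \<open>F\<close>, all
    number variables \<open>a\<close>.\<close>
  from conjunct2[OF assms[unfolded models_def], THEN bspec, OF this, rule_format, of "\<lambda>_. F" "\<lambda>_. a"] Fs
  have bound: "(\<forall>x. x \<preceq> a \<longrightarrow> (\<exists>y. \<forall>v. y \<prec> v \<longrightarrow> \<langle>v, x\<rangle> \<notin> F)) \<longrightarrow>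
      (\<exists>z. \<forall>x. x \<preceq> a \<longrightarrow> (\<exists>y. y \<preceq> z \<and> (\<forall>v. y \<prec> v \<longrightarrow> \<langle>v, x\<rangle> \<notin> F)))"
    by (simp add: \<phi>_def)
  have "\<exists>x. x \<preceq> a \<and> (\<forall>y. \<exists>v. y \<prec> v \<and> \<langle>v, x\<rangle> \<in> F)"
  proof (rule ccontr)
    assume "\<not> ?thesis"
    with bound obtain z where z: "\<And>x. x \<preceq> a \<Longrightarrow> \<exists>y. y \<preceq> z \<and> (\<forall>v. y \<prec> v \<longrightarrow> \<langle>v, x\<rangle> \<notin> F)" by blast
    \<comment> \<open>The colour of z + 1 should not occur beyond some
      \<open>y \<preceq> z\<close>.\<close>
    obtain x where x: "\<langle>z \<oplus> \<one>, x\<rangle> \<in> F" using Ftot by blast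
    then have "x \<preceq> a" using Fn[OF x] by (simp add: n)
    from z[OF this] x show False by auto
  qed
  then obtain x where x: "x \<preceq> a" "\<And>y. \<exists>v. y \<prec> v \<and> \<langle>v, x\<rangle> \<in> F" by blast
  show "\<exists>A\<in>sets M. \<exists>i. (\<forall>k. \<exists>j. k \<prec> j \<and> j \<in> A) \<and> i \<prec> n \<and> (\<forall>j. j \<in> A \<longrightarrow> \<langle>j, i\<rangle> \<in> F)"
  proof (rule bexI[of _ "{j. \<langle>j, x\<rangle> \<in> F}"], rule exI[of _ x], intro conjI allI)
    show "{j. \<langle>j, x\<rangle> \<in> F} \<in> sets M" by (intro delta0_comprehension delta0_rules Fs)
    show "\<exists>j. k \<prec> j \<and> j \<in> {j. \<langle>j, x\<rangle> \<in> F}" for k using x(2)[of k] by simp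
    show "x \<prec> n" using x(1) by (simp add: n)
  qed simp
qed

lemma bounding_if_pigeonhole:
  assumes pigeonhole and \<theta>: "delta0 M (\<lambda>e. \<theta> (e 0) (e 1) (e 2) (e 3))"
    and ex: "\<And>x. x \<preceq> a \<Longrightarrow> \<exists>y u. \<forall>v. \<theta> x y u v"
  shows "\<exists>z. \<forall>x. x \<preceq> a \<longrightarrow> (\<exists>y. y \<preceq> z \<and> (\<exists>u. \<forall>v. \<theta> x y u v))"
proof (rule ccontr)
  assume unbounded: "\<not> ?thesis"
  \<comment> \<open>Stage s of the search: some witnesses up to \<open>w\<close> have not been
    refuted by any \<open>v \<preceq> s\<close>. For growing s this can only turn from true to
    false.\<close>
  define \<psi> where "\<psi> x w s \<longleftrightarrow> (\<exists>y. y \<preceq> w \<and> (\<exists>u. u \<preceq> w \<and> (\<forall>v. v \<preceq> s \<longrightarrow> \<theta> x y u v)))" for x w s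
  note rules = delta0_bex_leq delta0_ball_leq delta0_rules delta0_subst4[OF \<theta>]
  have fail: "\<exists>s x. x \<preceq> a \<and> \<not> \<psi> x w s" for w
  proof -
    from unbounded obtain x where x: "x \<preceq> a" "\<And>y u. y \<preceq> w \<Longrightarrow> \<exists>v. \<not> \<theta> x y u v" by blast
    \<comment> \<open>Collection is applied once for u with y fixed and once for y, which yields one
      stage that refutes all pairs of witnesses.\<close>
    have "\<exists>s. \<forall>u. u \<preceq> w \<longrightarrow> (\<exists>v. v \<preceq> s \<and> \<not> \<theta> x y u v)" if "y \<preceq> w" for y
      using that x by (intro collection) (intro rules)
    then have "\<exists>s. \<forall>y. y \<preceq> w \<longrightarrow> (\<exists>s'. s' \<preceq> s \<and> (\<forall>u. u \<preceq> w \<longrightarrow> (\<exists>v. v \<preceq> s' \<and> \<not> \<theta> x y u v)))"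
    proof (rule collection[rotated])
      show "delta0 M (\<lambda>e. \<forall>u. u \<preceq> w \<longrightarrow> (\<exists>v. v \<preceq> e 1 \<and> \<not> \<theta> x (e 0) u v))" by (intro rules)
    qed
    then obtain s where s: "\<And>y. y \<preceq> w \<Longrightarrow> \<exists>s'. s' \<preceq> s \<and> (\<forall>u. u \<preceq> w \<longrightarrow> (\<exists>v. v \<preceq> s' \<and> \<not> \<theta> x y u v))"
      by blast
    have "\<not> \<psi> x w s" unfolding \<psi>_def using s leq_trans by meson
    with x show ?thesis by blast
  qed
  \<comment> \<open>The first stage at which some x fails, and the least x failing there. The double
    minimum makes the value unique while the matrix stays bounded; the least x that ever fails would
    not be found by such a search.\<close>
  define G where "G w x \<longleftrightarrow> (\<exists>s. (x \<preceq> a \<and> \<not> \<psi> x w s) \<and> (\<forall>x'. x' \<prec> x \<longrightarrow> \<psi> x' w s) \<and>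
    (\<forall>s'. s' \<prec> s \<longrightarrow> (\<forall>x'. x' \<preceq> a \<longrightarrow> \<psi> x' w s')))" for w x
  have "sigma1 M (\<lambda>e. G (e 0) (e 1))" unfolding G_def \<psi>_def by (intro sigma1_ex_delta0 rules)
  moreover have "\<exists>!x. G w x" for w
  proof -
    from fail obtain s0 x0 where "x0 \<preceq> a \<and> \<not> \<psi> x0 w s0" by blast
    then have s0: "\<exists>x. x \<preceq> a \<and> \<not> \<psi> x w s0" by blast
    have "delta0 M (\<lambda>e. \<exists>x. x \<preceq> a \<and> \<not> \<psi> x w (e 0))" unfolding \<psi>_def by (intro rules)
    from this s0 obtain s where s: "\<exists>x. x \<preceq> a \<and> \<not> \<psi> x w s"
      "\<And>k. k \<prec> s \<Longrightarrow> \<not> (\<exists>x. x \<preceq> a \<and> \<not> \<psi> x w k)"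
      by (rule least_number[of "\<lambda>s. \<exists>x. x \<preceq> a \<and> \<not> \<psi> x w s"]) (rule that)
    then obtain x1 where x1: "x1 \<preceq> a" "\<not> \<psi> x1 w s" by blast
    have "delta0 M (\<lambda>e. \<not> \<psi> (e 0) w s)" unfolding \<psi>_def by (intro rules)
    from this x1(2) obtain x where x: "\<not> \<psi> x w s" "\<And>k. k \<prec> x \<Longrightarrow> \<not> \<not> \<psi> k w s" "x \<preceq> x1"
      by (rule least_number[of "\<lambda>x. \<not> \<psi> x w s"]) (rule that)
    then have xa: "x \<preceq> a" using x1 leq_trans by blast
    show ?thesis
    proof (rule ex1I[of _ x])
      show "G w x" unfolding G_def using x s xa by blast
      fix x' assume "G w x'"
      then obtain s' where s': "x' \<preceq> a" "\<not> \<psi> x' w s'" "\<And>x''. x'' \<prec> x' \<Longrightarrow> \<psi> x'' w s'"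
        "\<And>k x''. k \<prec> s' \<Longrightarrow> x'' \<preceq> a \<Longrightarrow> \<psi> x'' w k" unfolding G_def by blast
      have "s' = s" using s s' by (metis N.neq_iff)
      then show "x' = x" using s' x by (metis N.neq_iff)
    qed
  qed
  ultimately obtain F where F: "fun_set F" "\<And>w x. \<langle>w, x\<rangle> \<in> F \<longleftrightarrow> G w x" by (rule function_exists) (rule that)
  have "x \<prec> a \<oplus> \<one>" if "\<langle>w, x\<rangle> \<in> F" for w x using that unfolding F(2) G_def by auto
  with assms(1) F(1) obtain A x where A: "\<And>k. \<exists>j. k \<prec> j \<and> j \<in> A" and x: "x \<prec> a \<oplus> \<one>"
    and Ax: "\<And>j. j \<in> A \<Longrightarrow> \<langle>j, x\<rangle> \<in> F" unfolding pigeonhole_def by blast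
  have "x \<preceq> a" using x by simp
  with ex obtain y u where yu: "\<And>v. \<theta> x y u v" by blast
  \<comment> \<open>Beyond the sum both true witnesses lie below w, so no stage can refute them and
    w cannot have colour x.\<close>
  obtain w where w: "y \<oplus> u \<prec> w" "w \<in> A" using A by blast
  then have "y \<preceq> w" "u \<preceq> w" by (meson N.order.strict_implies_order leq_add leq_trans)+
  then have "\<psi> x w s" for s unfolding \<psi>_def using yu by blast
  moreover have "\<exists>s. \<not> \<psi> x w s" using Ax[OF w(2)] unfolding F(2) G_def by blast
  ultimately show False by blast
qed

lemma models_BSigma02_if_pigeonhole:
  assumes pigeonhole
  shows "M \<^bold>\<Turnstile> BSigma02"
  unfolding models_def
proof (intro conjI ballI allI impI sets_nonempty)
  fix \<Phi> e and E :: "string \<Rightarrow> 'a set" assume "\<Phi> \<in> BSigma02" and E: "\<forall>X. E X \<in> sets M"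
  then obtain \<phi> x y z a where \<Phi>: "\<Phi> = ((\<^bold>\<forall>x. Var x \<^bold>\<le> Var a \<^bold>\<longrightarrow> (\<^bold>\<exists>y. \<phi>)) \<^bold>\<longrightarrow>
      (\<^bold>\<exists>z. \<^bold>\<forall>x. Var x \<^bold>\<le> Var a \<^bold>\<longrightarrow> (\<^bold>\<exists>y. Var y \<^bold>\<le> Var z \<^bold>\<and> \<phi>)))"
    and \<phi>: "\<phi> \<in> Sigma02" and dist: "distinct [x, y, z, a]" and z: "z \<notin> fv \<phi>"
    unfolding BSigma02_def by blast
  from \<phi> obtain u v \<theta> where \<phi>: "\<phi> = (\<^bold>\<exists>u. \<^bold>\<forall>v. \<theta>)" and \<theta>: "bounded_fm \<theta>"
    unfolding Sigma02_def Pi01_def by blast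
  \<comment> \<open>The names \<open>u\<close> and \<open>v\<close> come from the formula and may
    coincide with each other or with \<open>x\<close> and \<open>y\<close>. The last update wins, as
    the innermost binder does, and \<open>\<tau>\<close> below tests the names in the matching
    order.\<close>
  define \<Theta> where "\<Theta> b c d f \<longleftrightarrow> sat M (e(x := b, y := c, u := d, v := f)) E \<theta>" for b c d f
  define \<tau> :: "string \<Rightarrow> (nat \<Rightarrow> 'a) \<Rightarrow> 'a" where "\<tau> s = (if s = v then (\<lambda>e'. e' 3) else if s = u then (\<lambda>e'. e' 2)
    else if s = y then (\<lambda>e'. e' 1) else if s = x then (\<lambda>e'. e' 0) else (\<lambda>e'. e s))" for s
  have "term_fun M (\<tau> s)" for s by (auto simp: \<tau>_def intro: term_fun.intros)
  then have "delta0 M (\<lambda>e'. sat M (\<lambda>s. \<tau> s e') E \<theta>)" using \<theta> E by (intro sat_bounded_delta0) auto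
  also have "(\<lambda>e'. sat M (\<lambda>s. \<tau> s e') E \<theta>) = (\<lambda>e'. \<Theta> (e' 0) (e' 1) (e' 2) (e' 3))"
    unfolding \<Theta>_def by (intro ext arg_cong[where f="\<lambda>e. sat M e E \<theta>"]) (auto simp: \<tau>_def)
  finally have \<Theta>: "delta0 M (\<lambda>e'. \<Theta> (e' 0) (e' 1) (e' 2) (e' 3))" .
  \<comment> \<open>This is where the condition that \<open>z\<close> is not free in the formula
    enters.\<close>
  have z': "sat M (e(z := k, x := b, y := c)) E \<phi> \<longleftrightarrow> sat M (e(x := b, y := c)) E \<phi>" for k b c
    by (rule sat_cong) (use z in auto)
  have \<phi>_iff: "sat M (e(x := b, y := c)) E \<phi> \<longleftrightarrow> (\<exists>d. \<forall>f. \<Theta> b c d f)" for b c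
    by (simp add: \<phi> \<Theta>_def)
  have neq: "x \<noteq> y" "x \<noteq> z" "x \<noteq> a" "y \<noteq> z" "y \<noteq> a" "z \<noteq> a" "a \<noteq> x" "a \<noteq> z" "z \<noteq> x" "z \<noteq> y"
    using dist by auto
  have "sat M e E \<Phi> \<longleftrightarrow> ((\<forall>b. b \<preceq> e a \<longrightarrow> (\<exists>c d. \<forall>f. \<Theta> b c d f)) \<longrightarrow>
      (\<exists>k. \<forall>b. b \<preceq> e a \<longrightarrow> (\<exists>c. c \<preceq> k \<and> (\<exists>d. \<forall>f. \<Theta> b c d f))))"
    unfolding \<Phi> by (simp add: neq z' \<phi>_iff)
  then show "sat M e E \<Phi>" using bounding_if_pigeonhole[OF assms \<Theta>, of "e a"] by blast
qed

end

theorem mainTheorem9: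
  fixes M :: "'a structure2"
  assumes "M \<^bold>\<Turnstile> RCA0"
  shows "(M \<^bold>\<Turnstile> {WQP_disjoint_union} \<longleftrightarrow> M \<^bold>\<Turnstile> {WQP_product}) \<and>
         (M \<^bold>\<Turnstile> {WQP_product} \<longleftrightarrow> M \<^bold>\<Turnstile> {RT1}) \<and>
         (M \<^bold>\<Turnstile> {RT1} \<longleftrightarrow> M \<^bold>\<Turnstile> BSigma02)"
proof -
  interpret rca0_model M by (rule rca0_model.intro) (rule assms)
  show ?thesis
    using wqo_product_leq_if_eq wqo_product_eq_if_pigeonhole pigeonhole_if_wqo_product_leq
      pigeonhole_if_bounding models_BSigma02_if_pigeonhole
    unfolding models_WQP_disjoint_union models_WQP_product models_RT1 by blast
qed

end
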